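(* Let $G=(V,E)$ be a connected finite graph and let $s\in(0,1)$. Suppose that $\rho>0$ is a given parameter, and that $h\in C(V)$ changes sign and satisfies $\max_V h>0$. Let $\mathscr{M}=\{u\in W^{s,2}(V):\int_V he^u d\mu=1\}$, and consider the flow $$\frac{\partial}{\partial t}u=\alpha(t)h-R,\quad (x,t)\in V\times(0,+\infty),\qquad u(x,0)=u_0(x),\quad x\in V, \qquad (\ast\ast)$$ where $$R=\frac1\rho e^{-u}\left((-\Delta)^s u+\frac{\rho}{|V|}\right),\qquad \alpha(t)=\frac{\int_V hRe^u d\mu}{\int_V h^2e^u d\mu}.$$ Then for any initial function $u_0\in\mathscr{M}$: (i) there exists a unique solution $u:V\times[0,+\infty)\to\mathbb{R}$ of $(\ast\ast)$; (ii) there exist an increasing sequence $t_n\to+\infty$ and some function $u_\infty\in\mathscr{M}$ such that $u(x,t_n)$ converges to $u_\infty$ uniformly in $x\in V$ as $n\to+\infty$. Moreover, $u_\infty$ is a solution of the mean field equation $$(-\Delta)^s u=\rho\left(\frac{he^u}{\int_V he^u d\mu}-\frac{1}{|V|}\right)\quad\text{for all }x\in V.$$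
   Context: Setting: $G=(V,E)$ is a finite graph (finite vertex set $V$, $\sharp V\ge 2$) that is simple (no loops or multiple edges), undirected and connected, with a positive vertex measure $\mu:V\to(0,+\infty)$ and positive symmetric edge weights $w_{xy}=w_{yx}>0$ for $xy\in E$. $C(V)$ is the set of all functions $V\to\mathbb{R}$; $\int_V u\,d\mu=\sum_{x\in V}\mu(x)u(x)$; $|V|=\sum_{x\in V}\mu(x)$. The Laplacian is $\Delta u(x)=\frac1{\mu(x)}\sum_{y\sim x}w_{xy}(u(y)-u(x))$. With $N=\sharp V$, the eigenvalues of $-\Delta$ are $0=\lambda_0<\lambda_1\le\cdots\le\lambda_{N-1}$, with eigenfunctions $\phi_0,\dots,\phi_{N-1}$ orthonormal for $\langle u,v\rangle=\sum_{x\in V}\mu(x)u(x)v(x)$. For $s\in(0,1)$ and $x\ne y$ put $W_s(x,y)=-\mu(x)\mu(y)\sum_{i=0}^{N-1}\lambda_i^s\phi_i(x)\phi_i(y)$ (with $\lambda_0^s=0$); one has $0<W_s(x,y)=W_s(y,x)<+\infty$. The fractional Laplacian (acting in the variable $x$) is $$(-\Delta)^s u(x)=\frac{1}{\mu(x)}\sum_{y\in V,\,y\ne x}W_s(x,y)(u(x)-u(y)),$$ and $|\nabla^s u|^2(x)=\frac{1}{2\mu(x)}\sum_{y\in V,\,y\neq x}W_s(x,y)(u(x)-u(y))^2$. $W^{s,2}(V)$ is the set of $u\in C(V)$ with $\int_V(|\nabla^s u|^2+|u|^2)d\mu<+\infty$; since $V$ is finite, $W^{s,2}(V)=C(V)$.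 *)

theory Defs
  imports "HOL-Analysis.Analysis"
begin

text \<open>
  The vertex set is a finite type. \<open>E\<close> is the adjacency relation, so an
  undirected edge \<open>xy\<close> is the two pairs \<open>(x, y)\<close> and \<open>(y, x)\<close>; values of the weight \<open>w\<close>
  off \<open>E\<close> are irrelevant.
\<close>

locale weighted_graph =
  fixes E :: "'v::finite rel"
    and w :: "'v \<Rightarrow> 'v \<Rightarrow> real"
    and \<mu> :: "'v \<Rightarrow> real"
  assumes card_vertices: "2 \<le> CARD('v)"
    and edges_sym: "sym E"
    and edges_irrefl: "irrefl E"
    and connected: "\<And>x y. (x, y) \<in> E\<^sup>*"
    and measure_pos: "\<And>x. 0 < \<mu> x"
    and weight_pos: "\<And>x y. (x, y) \<in> E \<Longrightarrow> 0 < w x y"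
    and weight_sym: "\<And>x y. (x, y) \<in> E \<Longrightarrow> w x y = w y x"

definition vintegral :: "('v::finite \<Rightarrow> real) \<Rightarrow> ('v \<Rightarrow> real) \<Rightarrow> real" where
  "vintegral \<mu> u = (\<Sum>x\<in>UNIV. \<mu> x * u x)"

definition volume :: "('v::finite \<Rightarrow> real) \<Rightarrow> real" where
  "volume \<mu> = (\<Sum>x\<in>UNIV. \<mu> x)"

definition laplacian ::
  "'v::finite rel \<Rightarrow> ('v \<Rightarrow> 'v \<Rightarrow> real) \<Rightarrow> ('v \<Rightarrow> real) \<Rightarrow> ('v \<Rightarrow> real) \<Rightarrow> 'v \<Rightarrow> real" where
  "laplacian E w \<mu> u x = (1 / \<mu> x) * (\<Sum>y\<in>{y. (x, y) \<in> E}. w x y * (u y - u x))"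

text \<open>
  A complete orthonormal system of eigenfunctions of the negative Laplacian, with
  eigenvalues in increasing order; indices at or above \<open>CARD('v)\<close> are irrelevant.
  On a connected graph with at least two vertices \<open>lam 0 = 0 < lam 1\<close> follows, so it is
  not imposed here.
\<close>

definition laplacian_eigensystem ::
  "'v::finite rel \<Rightarrow> ('v \<Rightarrow> 'v \<Rightarrow> real) \<Rightarrow> ('v \<Rightarrow> real) \<Rightarrow>
    (nat \<Rightarrow> real) \<Rightarrow> (nat \<Rightarrow> 'v \<Rightarrow> real) \<Rightarrow> bool" where
  "laplacian_eigensystem E w \<mu> lam \<phi> \<longleftrightarrow>
    (\<forall>i<CARD('v). \<forall>x. - laplacian E w \<mu> (\<phi> i) x = lam i * \<phi> i x) \<and>
    (\<forall>i<CARD('v). \<forall>j<CARD('v).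
      vintegral \<mu> (\<lambda>x. \<phi> i x * \<phi> j x) = (if i = j then 1 else 0)) \<and>
    (\<forall>i j. i \<le> j \<longrightarrow> j < CARD('v) \<longrightarrow> lam i \<le> lam j)"

text \<open>
  Only the values at \<open>x \<noteq> y\<close> are used. Since \<open>0 powr s = 0\<close>, the eigenvalue zero
  contributes nothing, as required by the convention \<open>\<lambda>\<^sub>0\<^sup>s = 0\<close>.
\<close>

definition frac_weight ::
  "('v::finite \<Rightarrow> real) \<Rightarrow> (nat \<Rightarrow> real) \<Rightarrow> (nat \<Rightarrow> 'v \<Rightarrow> real) \<Rightarrow> real \<Rightarrow> 'v \<Rightarrow> 'v \<Rightarrow> real" where
  "frac_weight \<mu> lam \<phi> s x y =
    - \<mu> x * \<mu> y * (\<Sum>i<CARD('v). lam i powr s * \<phi> i x * \<phi> i y)"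

definition frac_laplacian ::
  "('v::finite \<Rightarrow> real) \<Rightarrow> (nat \<Rightarrow> real) \<Rightarrow> (nat \<Rightarrow> 'v \<Rightarrow> real) \<Rightarrow> real \<Rightarrow>
    ('v \<Rightarrow> real) \<Rightarrow> 'v \<Rightarrow> real" where
  "frac_laplacian \<mu> lam \<phi> s u x =
    (1 / \<mu> x) * (\<Sum>y\<in>UNIV - {x}. frac_weight \<mu> lam \<phi> s x y * (u x - u y))"

definition frac_grad_sq ::
  "('v::finite \<Rightarrow> real) \<Rightarrow> (nat \<Rightarrow> real) \<Rightarrow> (nat \<Rightarrow> 'v \<Rightarrow> real) \<Rightarrow> real \<Rightarrow>
    ('v \<Rightarrow> real) \<Rightarrow> 'v \<Rightarrow> real" where
  "frac_grad_sq \<mu> lam \<phi> s u x =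
    (1 / (2 * \<mu> x)) * (\<Sum>y\<in>UNIV - {x}. frac_weight \<mu> lam \<phi> s x y * (u x - u y)\<^sup>2)"

text \<open>The space \<open>W\<^sup>s\<^sup>,\<^sup>2(V)\<close>; the vertex set being finite, it contains every function.\<close>

definition frac_sobolev ::
  "('v::finite \<Rightarrow> real) \<Rightarrow> (nat \<Rightarrow> real) \<Rightarrow> (nat \<Rightarrow> 'v \<Rightarrow> real) \<Rightarrow> real \<Rightarrow> ('v \<Rightarrow> real) set" where
  "frac_sobolev \<mu> lam \<phi> s =
    {u. ereal (vintegral \<mu> (\<lambda>x. frac_grad_sq \<mu> lam \<phi> s u x + \<bar>u x\<bar>\<^sup>2)) < \<infinity>}"

lemma frac_sobolev_eq_UNIV: "frac_sobolev \<mu> lam \<phi> s = UNIV"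
  by (simp add: frac_sobolev_def)

definition constraint_set ::
  "('v::finite \<Rightarrow> real) \<Rightarrow> (nat \<Rightarrow> real) \<Rightarrow> (nat \<Rightarrow> 'v \<Rightarrow> real) \<Rightarrow> real \<Rightarrow>
    ('v \<Rightarrow> real) \<Rightarrow> ('v \<Rightarrow> real) set" where
  "constraint_set \<mu> lam \<phi> s h =
    {u \<in> frac_sobolev \<mu> lam \<phi> s. vintegral \<mu> (\<lambda>x. h x * exp (u x)) = 1}"

definition flow_R ::
  "('v::finite \<Rightarrow> real) \<Rightarrow> (nat \<Rightarrow> real) \<Rightarrow> (nat \<Rightarrow> 'v \<Rightarrow> real) \<Rightarrow> real \<Rightarrow> real \<Rightarrow>
    ('v \<Rightarrow> real) \<Rightarrow> 'v \<Rightarrow> real" where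
  "flow_R \<mu> lam \<phi> s \<rho> u x =
    (1 / \<rho>) * exp (- u x) * (frac_laplacian \<mu> lam \<phi> s u x + \<rho> / volume \<mu>)"

definition flow_alpha ::
  "('v::finite \<Rightarrow> real) \<Rightarrow> (nat \<Rightarrow> real) \<Rightarrow> (nat \<Rightarrow> 'v \<Rightarrow> real) \<Rightarrow> real \<Rightarrow> real \<Rightarrow>
    ('v \<Rightarrow> real) \<Rightarrow> ('v \<Rightarrow> real) \<Rightarrow> real" where
  "flow_alpha \<mu> lam \<phi> s \<rho> h u =
    vintegral \<mu> (\<lambda>x. h x * flow_R \<mu> lam \<phi> s \<rho> u x * exp (u x)) /
    vintegral \<mu> (\<lambda>x. (h x)\<^sup>2 * exp (u x))"

text \<open>
  Classical solutions: the equation holds for \<open>t > 0\<close>, and continuity on the closed half-line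
  ties the initial value to the evolution. Values \<open>u x t\<close> with \<open>t < 0\<close> are irrelevant.
\<close>

definition solves_flow ::
  "('v::finite \<Rightarrow> real) \<Rightarrow> (nat \<Rightarrow> real) \<Rightarrow> (nat \<Rightarrow> 'v \<Rightarrow> real) \<Rightarrow> real \<Rightarrow> real \<Rightarrow>
    ('v \<Rightarrow> real) \<Rightarrow> ('v \<Rightarrow> real) \<Rightarrow> ('v \<Rightarrow> real \<Rightarrow> real) \<Rightarrow> bool" where
  "solves_flow \<mu> lam \<phi> s \<rho> h u0 u \<longleftrightarrow>
    (\<forall>x. u x 0 = u0 x) \<and>
    (\<forall>x. continuous_on {0..} (u x)) \<and>
    (\<forall>x. \<forall>t>0. (u x has_real_derivative
      flow_alpha \<mu> lam \<phi> s \<rho> h (\<lambda>y. u y t) * h x - flow_R \<mu> lam \<phi> s \<rho> (\<lambda>y. u y t) x) (at t))"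

definition solves_mean_field ::
  "('v::finite \<Rightarrow> real) \<Rightarrow> (nat \<Rightarrow> real) \<Rightarrow> (nat \<Rightarrow> 'v \<Rightarrow> real) \<Rightarrow> real \<Rightarrow> real \<Rightarrow>
    ('v \<Rightarrow> real) \<Rightarrow> ('v \<Rightarrow> real) \<Rightarrow> bool" where
  "solves_mean_field \<mu> lam \<phi> s \<rho> h u \<longleftrightarrow>
    (\<forall>x. frac_laplacian \<mu> lam \<phi> s u x =
      \<rho> * (h x * exp (u x) / vintegral \<mu> (\<lambda>y. h y * exp (u y)) - 1 / volume \<mu>))"

end

theory Submission
  imports Defs
begin

text \<open>
  Along the flow the constraint \<open>\<integral> h e\<^sup>u d\<mu> = 1\<close> is preserved, and the energy
  \<open>1/2 \<integral> u (-\<Delta>)\<^sup>s u d\<mu> + \<rho>/|V| \<integral> u d\<mu>\<close> decreases at the rate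
  \<open>\<rho> \<integral> e\<^sup>u (\<alpha> h - R)\<^sup>2 d\<mu>\<close>. By the spectral gap, the quadratic part of the energy controls the
  oscillation of \<open>u\<close>, while the constraint bounds the maximum of \<open>u\<close> from below, so energy sublevel
  sets are bounded on the constraint set. This a priori bound makes solutions global. Since the
  energy is bounded below, its dissipation tends to zero along some sequence of times, and every
  limit point of the solution along it is stationary; integrating the stationary equation shows
  that \<open>\<alpha> = 1\<close> there, which is the mean field equation.
\<close>

section \<open>Maps that are Lipschitz on balls\<close>

text \<open>Equivalent to local Lipschitz continuity, since closed balls are compact. Stated on
  balls, the property can be derived by rules that follow the syntax of the vector field, collected
  in \<open>ball_lipschitz_intros\<close>.\<close>

definition ball_lipschitz :: "('a::euclidean_space \<Rightarrow> 'b::real_normed_vector) \<Rightarrow> bool" where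
  "ball_lipschitz f \<longleftrightarrow> (\<forall>r. \<exists>L. L-lipschitz_on (cball 0 r) f)"

named_theorems ball_lipschitz_intros

lemma ball_lipschitzD: "ball_lipschitz f \<Longrightarrow> \<exists>L. L-lipschitz_on (cball 0 r) f"
  by (simp add: ball_lipschitz_def)

lemma ball_lipschitz_continuous_on:
  fixes f :: "'a::euclidean_space \<Rightarrow> 'b::real_normed_vector"
  assumes "ball_lipschitz f"
  shows "continuous_on S f"
proof (rule continuous_on_subset[OF _ subset_UNIV], rule continuous_at_imp_continuous_on, rule ballI)
  fix x :: 'a
  obtain L where "L-lipschitz_on (cball 0 (norm x + 1)) f"
    using ball_lipschitzD[OF assms] by blast
  then have "continuous_on (ball 0 (norm x + 1)) f"
    using ball_subset_cball lipschitz_on_continuous_on continuous_on_subset by blast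
  then show "isCont f x"
    by (simp add: continuous_on_eq_continuous_at)
qed

lemma ball_lipschitz_bounded:
  assumes "ball_lipschitz f"
  shows "\<exists>M\<ge>0. \<forall>x\<in>cball 0 r. norm (f x) \<le> M"
proof -
  have "bounded (f ` cball 0 r)"
    using ball_lipschitz_continuous_on[OF assms]
    by (intro compact_imp_bounded compact_continuous_image) auto
  then show ?thesis
    unfolding bounded_pos by (auto intro: less_imp_le)
qed

lemma ball_lipschitz_const [ball_lipschitz_intros]: "ball_lipschitz (\<lambda>x. c)"
  unfolding ball_lipschitz_def using lipschitz_on_constant by blast

lemma ball_lipschitz_nth [ball_lipschitz_intros]: "ball_lipschitz (\<lambda>x :: real ^ 'n. x $ i)"
  unfolding ball_lipschitz_def using bounded_linear.lipschitz_boundE[OF bounded_linear_vec_nth]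
  by metis

lemma ball_lipschitz_add [ball_lipschitz_intros]:
  "ball_lipschitz f \<Longrightarrow> ball_lipschitz g \<Longrightarrow> ball_lipschitz (\<lambda>x. f x + g x)"
  unfolding ball_lipschitz_def by (blast intro: lipschitz_on_add)

lemma ball_lipschitz_diff [ball_lipschitz_intros]:
  "ball_lipschitz f \<Longrightarrow> ball_lipschitz g \<Longrightarrow> ball_lipschitz (\<lambda>x. f x - g x)"
  unfolding ball_lipschitz_def by (blast intro: lipschitz_on_diff)

lemma ball_lipschitz_minus [ball_lipschitz_intros]:
  "ball_lipschitz f \<Longrightarrow> ball_lipschitz (\<lambda>x. - f x)"
  by (simp add: ball_lipschitz_def)

lemma ball_lipschitz_sum [ball_lipschitz_intros]:
  "(\<And>i. i \<in> I \<Longrightarrow> ball_lipschitz (f i)) \<Longrightarrow> ball_lipschitz (\<lambda>x. \<Sum>i\<in>I. f i x)"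
  by (induction I rule: infinite_finite_induct)
    (simp_all add: ball_lipschitz_const ball_lipschitz_add)

text \<open>Global Lipschitz continuity is not stable under products. On a ball both factors are
  also bounded, and \<open>f x * g x - f y * g y\<close> splits into two terms, each with one
  bounded and one Lipschitz factor.\<close>

lemma ball_lipschitz_mult [ball_lipschitz_intros]:
  fixes f g :: "'a::euclidean_space \<Rightarrow> real"
  assumes f: "ball_lipschitz f" and g: "ball_lipschitz g"
  shows "ball_lipschitz (\<lambda>x. f x * g x)"
  unfolding ball_lipschitz_def
proof
  fix r
  obtain C D where C: "C-lipschitz_on (cball 0 r) f" and D: "D-lipschitz_on (cball 0 r) g"
    using f g by (meson ball_lipschitzD)
  obtain M N where M: "0 \<le> M" "\<And>x. x \<in> cball 0 r \<Longrightarrow> \<bar>f x\<bar> \<le> M"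
    and N: "0 \<le> N" "\<And>x. x \<in> cball 0 r \<Longrightarrow> \<bar>g x\<bar> \<le> N"
    using ball_lipschitz_bounded[OF f, of r] ball_lipschitz_bounded[OF g, of r] by auto
  have "(M * D + C * N)-lipschitz_on (cball 0 r) (\<lambda>x. f x * g x)"
  proof (rule lipschitz_onI)
    fix x y
    assume xy: "x \<in> cball (0::'a) r" "y \<in> cball (0::'a) r"
    have "f x * g x - f y * g y = f x * (g x - g y) + (f x - f y) * g y"
      by (simp add: algebra_simps)
    then have "\<bar>f x * g x - f y * g y\<bar> \<le> \<bar>f x\<bar> * \<bar>g x - g y\<bar> + \<bar>f x - f y\<bar> * \<bar>g y\<bar>"
      by (metis abs_mult abs_triangle_ineq)
    also have "\<dots> \<le> M * (D * dist x y) + C * dist x y * N"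
      using xy M N lipschitz_onD[OF C xy] lipschitz_onD[OF D xy] lipschitz_on_nonneg[OF C]
      by (intro add_mono mult_mono) (auto simp: dist_real_def)
    finally show "dist (f x * g x) (f y * g y) \<le> (M * D + C * N) * dist x y"
      by (simp add: dist_real_def algebra_simps)
  qed (use M N lipschitz_on_nonneg[OF C] lipschitz_on_nonneg[OF D] in simp)
  then show "\<exists>L. L-lipschitz_on (cball 0 r) (\<lambda>x. f x * g x)"
    by blast
qed

text \<open>The image of a ball is compact and connected, so it is an interval inside
  \<open>S\<close> on which \<open>g'\<close> is bounded; the mean value inequality then applies.
  The set \<open>S\<close> allows for functions smooth only on part of the line.\<close>

lemma ball_lipschitz_compose_deriv:
  fixes f :: "'a::euclidean_space \<Rightarrow> real" and g g' :: "real \<Rightarrow> real"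
  assumes f: "ball_lipschitz f" and S: "\<And>x. f x \<in> S"
    and g: "\<And>y. y \<in> S \<Longrightarrow> (g has_real_derivative g' y) (at y)"
    and g': "continuous_on S g'"
  shows "ball_lipschitz (\<lambda>x. g (f x))"
  unfolding ball_lipschitz_def
proof
  fix r
  let ?K = "f ` cball 0 r"
  have KS: "?K \<subseteq> S"
    using S by auto
  have fc: "continuous_on (cball 0 r) f"
    using f by (rule ball_lipschitz_continuous_on)
  have "compact ?K"
    by (intro compact_continuous_image fc) simp
  then have "bounded (g' ` ?K)"
    using continuous_on_subset[OF g' KS] compact_imp_bounded compact_continuous_image by blast
  then obtain B where B: "0 < B" "\<And>y. y \<in> ?K \<Longrightarrow> norm (g' y) \<le> B"
    unfolding bounded_pos by blast
  have "connected ?K"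
    by (intro connected_continuous_image fc) simp
  then have "convex ?K"
    using is_interval_connected_1 is_interval_convex_1 by metis
  have "B-lipschitz_on ?K g"
  proof (rule lipschitz_onI)
    fix a b
    assume ab: "a \<in> ?K" "b \<in> ?K"
    have "(g has_field_derivative g' y) (at y within ?K)" if "y \<in> ?K" for y
      using g[of y] KS that has_field_derivative_at_within by blast
    then have "norm (g a - g b) \<le> B * norm (a - b)"
      using B(2) ab by (rule field_differentiable_bound[OF \<open>convex ?K\<close>])
    then show "dist (g a) (g b) \<le> B * dist a b"
      by (simp only: dist_norm)
  qed (use B in simp)
  then show "\<exists>L. L-lipschitz_on (cball 0 r) (\<lambda>x. g (f x))"
    using ball_lipschitzD[OF f, of r] lipschitz_on_compose2 by blast
qed

lemma ball_lipschitz_exp [ball_lipschitz_intros]: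
  fixes f :: "'a::euclidean_space \<Rightarrow> real"
  assumes "ball_lipschitz f"
  shows "ball_lipschitz (\<lambda>x. exp (f x))"
  by (rule ball_lipschitz_compose_deriv[OF assms, where S = UNIV and g' = exp])
    (auto intro!: continuous_intros DERIV_exp)

text \<open>The denominator need not stay away from zero globally: reciprocals are smooth on the
  positive half-line, and compactness of the ball does the rest.\<close>

lemma ball_lipschitz_divide [ball_lipschitz_intros]:
  fixes f g :: "'a::euclidean_space \<Rightarrow> real"
  assumes "ball_lipschitz f" and "ball_lipschitz g" and "\<And>x. 0 < g x"
  shows "ball_lipschitz (\<lambda>x. f x / g x)"
proof -
  have "(inverse has_real_derivative - (inverse y)\<^sup>2) (at y)" if "y \<in> {0<..}" for y :: real
    using DERIV_inverse[of y] that by (simp add: power2_eq_square)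
  moreover have "continuous_on {0<..} (\<lambda>y :: real. - (inverse y)\<^sup>2)"
    by (intro continuous_intros) auto
  ultimately have "ball_lipschitz (\<lambda>x. inverse (g x))"
    using assms(3) by (intro ball_lipschitz_compose_deriv[OF assms(2)]) auto
  then show ?thesis
    unfolding divide_inverse by (intro ball_lipschitz_mult assms)
qed

lemma ball_lipschitz_vec_lambda:
  fixes f :: "'n::finite \<Rightarrow> 'a::euclidean_space \<Rightarrow> real"
  assumes "\<And>i. ball_lipschitz (f i)"
  shows "ball_lipschitz (\<lambda>x. \<chi> i. f i x)"
  unfolding ball_lipschitz_def
proof
  fix r
  have "\<forall>i. \<exists>L. L-lipschitz_on (cball 0 r) (f i)"
    using ball_lipschitzD[OF assms] by blast
  then obtain L where L: "\<And>i. (L i)-lipschitz_on (cball 0 r) (f i)"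
    using choice[of "\<lambda>i L. L-lipschitz_on (cball 0 r) (f i)"] by blast
  have "(\<Sum>i\<in>UNIV. L i)-lipschitz_on (cball 0 r) (\<lambda>x. \<chi> i. f i x)"
  proof (rule lipschitz_onI)
    fix x y
    assume xy: "x \<in> cball (0::'a) r" "y \<in> cball (0::'a) r"
    have "dist (\<chi> i. f i x) (\<chi> i. f i y) \<le> (\<Sum>i\<in>UNIV. \<bar>f i x - f i y\<bar>)"
      unfolding dist_norm by (rule order_trans[OF norm_le_l1_cart]) simp
    also have "\<dots> \<le> (\<Sum>i\<in>UNIV. L i * dist x y)"
      using lipschitz_onD[OF L xy] by (intro sum_mono) (auto simp: dist_real_def)
    finally show "dist (\<chi> i. f i x) (\<chi> i. f i y) \<le> (\<Sum>i\<in>UNIV. L i) * dist x y"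
      by (simp add: sum_distrib_right)
  qed (use lipschitz_on_nonneg[OF L] in \<open>simp add: sum_nonneg\<close>)
  then show "\<exists>L. L-lipschitz_on (cball 0 r) (\<lambda>x. \<chi> i. f i x)"
    by blast
qed

lemma has_vector_derivative_vec_lambda:
  fixes f :: "'n::finite \<Rightarrow> real \<Rightarrow> real"
  assumes "\<And>i. (f i has_real_derivative f' i) (at t)"
  shows "((\<lambda>t. \<chi> i. f i t) has_vector_derivative (\<chi> i. f' i)) (at t)"
proof -
  \<comment> \<open>Expansion in the standard basis turns the curve into a finite sum of scalar
    functions times fixed vectors.\<close>
  have eq: "(\<chi> i. g i) = (\<Sum>i\<in>UNIV. g i *\<^sub>R axis i 1)" for g :: "'n \<Rightarrow> real"
    by (simp add: vec_eq_iff axis_def if_distrib cong: if_cong)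
  show ?thesis
    unfolding eq using assms
    by (auto intro!: derivative_eq_intros simp: has_real_derivative_iff_has_vector_derivative)
qed

section \<open>Ordinary differential equations\<close>

lemma integral_has_vector_derivative_from_0:
  fixes f :: "real \<Rightarrow> 'a::banach"
  assumes "continuous_on {0..} f" and "0 < t"
  shows "((\<lambda>t. integral {0..t} f) has_vector_derivative f t) (at t)"
proof -
  have "continuous_on {0..t + 1} f"
    using assms(1) by (rule continuous_on_subset) auto
  then have "((\<lambda>t. integral {0..t} f) has_vector_derivative f t) (at t within {0..t + 1})"
    using assms(2) by (intro integral_has_vector_derivative) auto
  then show ?thesis
    using assms(2) by (simp add: at_within_Icc_at)
qed

lemma continuous_on_integral_from_0:
  fixes f :: "real \<Rightarrow> 'a::banach"
  assumes "continuous_on {0..} f"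
  shows "continuous_on {0..} (\<lambda>t. integral {0..t} f)"
  unfolding continuous_on_eq_continuous_within
proof
  fix t :: real
  assume t: "t \<in> {0..}"
  have "continuous_on {0..t + 1} f"
    using assms by (rule continuous_on_subset) auto
  then have "continuous_on {0..t + 1} (\<lambda>t. integral {0..t} f)"
    by (intro indefinite_integral_continuous_1 integrable_continuous_real)
  then have "continuous (at t within {0..t + 1}) (\<lambda>t. integral {0..t} f)"
    using t by (auto simp: continuous_on_eq_continuous_within)
  moreover have "at t within {0..t + 1} = at t within {0..}"
    by (rule at_within_nhd[where S = "{..<t + 1}"]) auto
  ultimately show "continuous (at t within {0..}) (\<lambda>t. integral {0..t} f)"
    by simp
qed

lemma integral_exp_from_0:
  fixes K t :: real
  assumes "0 < K" and "0 \<le> t"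
  shows "((\<lambda>r. exp (K * r)) has_integral (exp (K * t) - 1) / K) {0..t}"
proof -
  have "((\<lambda>r. exp (K * r)) has_integral (exp (K * t) / K - exp (K * 0) / K)) {0..t}"
    using assms
    by (intro fundamental_theorem_of_calculus)
      (auto intro!: derivative_eq_intros
        simp: has_real_derivative_iff_has_vector_derivative[symmetric])
  then show ?thesis
    by (simp add: diff_divide_distrib)
qed

text \<open>In the sup norm weighted by \<open>exp (- K * t)\<close>, integration gains a factor
  \<open>1 / K\<close>. This gives both the boundedness of the weighted Picard operator and its
  contraction property.\<close>

lemma norm_weighted_integral_le:
  fixes f :: "real \<Rightarrow> 'a::banach"
  assumes f: "continuous_on {0..} f" and K: "0 < K" and t: "0 \<le> t" and B: "0 \<le> B"
    and bound: "\<And>r. 0 \<le> r \<Longrightarrow> norm (f r) \<le> B * exp (K * r)"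
  shows "norm (exp (- K * t) *\<^sub>R integral {0..t} f) \<le> B / K"
proof -
  have "continuous_on {0..t} f"
    using f by (rule continuous_on_subset) auto
  then have "norm (integral {0..t} f) \<le> integral {0..t} (\<lambda>r. B * exp (K * r))"
    using bound
    by (intro integral_norm_bound_integral integrable_continuous_real continuous_intros) auto
  also have "\<dots> = B * ((exp (K * t) - 1) / K)"
    using integral_exp_from_0[OF K t] has_integral_mult_right integral_unique by blast
  also have "\<dots> \<le> B * (exp (K * t) / K)"
    using B K by (intro mult_left_mono divide_right_mono) auto
  finally have "exp (- K * t) * norm (integral {0..t} f) \<le> exp (- K * t) * (B * (exp (K * t) / K))"
    by (rule mult_left_mono) simp
  also have "\<dots> = B / K"
    using exp_minus_inverse[of "K * t"] by (simp add: exp_minus)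
  finally show ?thesis
    by simp
qed

text \<open>
  Writing a solution as \<open>u t = u0 + exp (K t) v t\<close> with \<open>v\<close> bounded makes the Picard operator a
  contraction on the whole half-line as soon as \<open>K\<close> exceeds the Lipschitz constant, so that no
  continuation argument is needed.
\<close>

lemma lipschitz_bounded_ode_exists:
  fixes F :: "'a::banach \<Rightarrow> 'a"
  assumes lip: "L-lipschitz_on UNIV F" and bound: "\<And>x. norm (F x) \<le> B"
  shows "\<exists>u. u 0 = u0 \<and> continuous_on {0..} u \<and>
    (\<forall>t>0. (u has_vector_derivative F (u t)) (at t))"
proof -
  \<comment> \<open>This choice gives contraction factor \<open>L / K \<le> 1 / 2\<close>, and the
    added 1 keeps \<open>K\<close> positive when \<open>L = 0\<close>.\<close>
  define K where "K = 2 * L + 1"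
  have L: "0 \<le> L"
    using lip by (rule lipschitz_on_nonneg)
  then have K: "0 < K" "L / K \<le> 1 / 2"
    by (auto simp: K_def field_simps)
  have B: "0 \<le> B"
    using bound[of 0] norm_ge_zero order_trans by blast
  have F: "continuous_on UNIV F"
    using lip by (rule lipschitz_on_continuous_on)
  \<comment> \<open>The vector field along the curve encoded by the weighted unknown
    \<open>v\<close>.\<close>
  define f where "f v r = F (u0 + exp (K * r) *\<^sub>R apply_bcontfun v r)" for v r
  \<comment> \<open>The Picard operator in the variable \<open>v\<close>. Bounded continuous
    functions are taken on the whole line, so \<open>max 0 t\<close> extends the values to negative
    times by 0.\<close>
  define T where "T v t = exp (- K * max 0 t) *\<^sub>R integral {0..max 0 t} (f v)" for v and t :: real
  have f_cont: "continuous_on S (f v)" for v S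
    unfolding f_def by (intro continuous_intros continuous_on_compose2[OF F]) auto
  have T_bcontfun: "T v \<in> bcontfun" for v
  proof (rule bcontfun_normI)
    have "continuous_on UNIV (\<lambda>t. integral {0..max 0 t} (f v))"
      by (rule continuous_on_compose2[OF continuous_on_integral_from_0[OF f_cont]])
        (auto intro!: continuous_intros)
    then show "continuous_on UNIV (T v)"
      unfolding T_def by (intro continuous_intros)
    have "norm (f v r) \<le> B * exp (K * r)" if "0 \<le> r" for r
    proof -
      have "B * 1 \<le> B * exp (K * r)"
        using that K B by (intro mult_left_mono) auto
      then show ?thesis
        using bound[of "u0 + exp (K * r) *\<^sub>R apply_bcontfun v r"] by (simp add: f_def)
    qed
    then show "norm (T v t) \<le> B / K" for t
      unfolding T_def using K B f_cont by (intro norm_weighted_integral_le) auto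
  qed
  have "\<exists>!v. Bcontfun (T v) = v"
  proof (rule banach_fix_type)
    show "\<forall>v w. dist (Bcontfun (T v)) (Bcontfun (T w)) \<le> 1 / 2 * dist v w"
    proof (intro allI dist_bound)
      fix v w t
      have *: "T v t - T w t = exp (- K * max 0 t) *\<^sub>R integral {0..max 0 t} (\<lambda>r. f v r - f w r)"
        unfolding T_def
        by (simp add: integral_diff integrable_continuous_real f_cont scaleR_diff_right)
      have "norm (f v r - f w r) \<le> (L * dist v w) * exp (K * r)" for r
      proof -
        have "norm (f v r - f w r) \<le> L * dist (u0 + exp (K * r) *\<^sub>R apply_bcontfun v r)
            (u0 + exp (K * r) *\<^sub>R apply_bcontfun w r)"
          unfolding f_def dist_norm by (rule lipschitz_on_normD[OF lip]) auto
        also have "\<dots> = L * (exp (K * r) * dist (apply_bcontfun v r) (apply_bcontfun w r))"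
          by (simp add: dist_norm flip: scaleR_diff_right)
        also have "\<dots> \<le> L * (exp (K * r) * dist v w)"
          using L by (intro mult_left_mono dist_bounded) auto
        finally show ?thesis
          by (simp add: mult_ac)
      qed
      then have "norm (T v t - T w t) \<le> L * dist v w / K"
        unfolding * using K L f_cont
        by (intro norm_weighted_integral_le continuous_intros) auto
      also have "\<dots> = L / K * dist v w"
        by simp
      also have "\<dots> \<le> 1 / 2 * dist v w"
        using K by (intro mult_right_mono) auto
      finally show "dist (apply_bcontfun (Bcontfun (T v)) t) (apply_bcontfun (Bcontfun (T w)) t)
          \<le> 1 / 2 * dist v w"
        by (simp add: Bcontfun_inverse T_bcontfun dist_norm)
    qed
  qed auto
  then obtain v where "Bcontfun (T v) = v"
    by blast
  then have v: "apply_bcontfun v = T v"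
    using Bcontfun_inverse[OF T_bcontfun] by metis
  \<comment> \<open>Defining the solution as an integral gives differentiability at once; the fixed
    point equation then identifies the integrand with \<open>F (u t)\<close> for nonnegative
    times.\<close>
  define u where "u t = u0 + integral {0..t} (f v)" for t
  have u: "u t = u0 + exp (K * t) *\<^sub>R apply_bcontfun v t" if "0 \<le> t" for t
    using that by (simp add: v T_def u_def flip: exp_add)
  have "(u has_vector_derivative F (u t)) (at t)" if "0 < t" for t
  proof -
    have "(u has_vector_derivative f v t) (at t)"
      unfolding u_def using integral_has_vector_derivative_from_0[OF f_cont that]
      by (auto intro!: derivative_eq_intros)
    then show ?thesis
      using u[of t] that by (simp add: f_def)
  qed
  moreover have "continuous_on {0..} u"
    unfolding u_def by (intro continuous_intros continuous_on_integral_from_0 f_cont)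
  moreover have "u 0 = u0"
    by (simp add: u_def)
  ultimately show ?thesis
    by blast
qed

text \<open>Composing \<open>F\<close> with the projection onto the ball of radius \<open>r\<close>
  gives a bounded, globally Lipschitz field, which has a global solution. At a first exit from the
  open ball this would still solve the original equation up to that time, contradicting the a priori
  bound.\<close>

lemma ode_global_exists:
  fixes F :: "'a::euclidean_space \<Rightarrow> 'a"
  assumes lip: "ball_lipschitz F"
    and apriori: "\<And>u T. \<lbrakk>0 < T; u 0 = u0; continuous_on {0..T} u;
        \<And>t. \<lbrakk>0 < t; t < T\<rbrakk> \<Longrightarrow> (u has_vector_derivative F (u t)) (at t)\<rbrakk> \<Longrightarrow> norm (u T) < r"
    and u0: "norm u0 < r"
  shows "\<exists>u. u 0 = u0 \<and> continuous_on {0..} u \<and>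
    (\<forall>t>0. (u has_vector_derivative F (u t)) (at t))"
proof -
  let ?p = "closest_point (cball 0 r :: 'a set)"
  have r: "0 < r"
    using u0 norm_ge_zero[of u0] by linarith
  obtain L where L: "L-lipschitz_on (cball 0 r) F"
    using ball_lipschitzD[OF lip] by blast
  have p: "?p x \<in> cball 0 r" for x
    using r by (intro closest_point_in_set) auto
  have "1-lipschitz_on UNIV ?p"
    using r by (intro lipschitz_onI) (auto intro!: closest_point_lipschitz)
  then have FL: "(L * 1)-lipschitz_on UNIV (\<lambda>x. F (?p x))"
    using p by (intro lipschitz_on_compose2 lipschitz_on_subset[OF L]) auto
  have "bounded (F ` cball 0 r)"
    using lipschitz_on_continuous_on[OF L] by (intro compact_imp_bounded compact_continuous_image) auto
  then obtain B where "\<And>x. norm (F (?p x)) \<le> B"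
    using p unfolding bounded_iff by blast
  then obtain u where u: "u 0 = u0" "continuous_on {0..} u"
    "\<And>t. 0 < t \<Longrightarrow> (u has_vector_derivative F (?p (u t))) (at t)"
    using lipschitz_bounded_ode_exists[OF FL] by blast
  have in_ball: "norm (u t) < r" if "0 \<le> t" for t
  proof (rule ccontr)
    assume "\<not> norm (u t) < r"
    \<comment> \<open>The times at which the solution is outside the open ball; the minimum of this
      compact set is the first exit time.\<close>
    define S where "S = {a \<in> {0..t}. r \<le> norm (u a)}"
    have ut: "continuous_on {0..t} u"
      using u(2) by (rule continuous_on_subset) auto
    have "closed S"
      unfolding S_def using ut
      by (intro continuous_closed_preimage_constant continuous_on_closed_Collect_le continuous_intros) auto
    moreover have "bounded S"
      by (rule bounded_subset[OF bounded_closed_interval[of 0 t]]) (auto simp: S_def)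
    ultimately have "compact S"
      by (simp add: compact_eq_bounded_closed)
    moreover have "S \<noteq> {}"
      using \<open>\<not> norm (u t) < r\<close> that by (auto simp: S_def)
    ultimately obtain T where T: "T \<in> S" "\<And>a. a \<in> S \<Longrightarrow> T \<le> a"
      using compact_attains_inf by metis
    have "0 < T"
      using T(1) u0 u(1) by (cases "T = 0") (auto simp: S_def)
    have small: "norm (u a) < r" if "0 \<le> a" "a < T" for a
      using T that by (force simp: S_def)
    have "norm (u T) < r"
    proof (rule apriori[where u = u and T = T, OF \<open>0 < T\<close> u(1)])
      show "continuous_on {0..T} u"
        using u(2) by (rule continuous_on_subset) auto
      \<comment> \<open>Before the exit time the solution stays in the ball, where the projection is
        the identity.\<close>
      show "(u has_vector_derivative F (u a)) (at a)" if "0 < a" "a < T" for a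
        using u(3)[of a] that small[of a] by (simp add: closest_point_self)
    qed
    then show False
      using T(1) by (simp add: S_def)
  qed
  have "(u has_vector_derivative F (u t)) (at t)" if "0 < t" for t
    using u(3)[OF that] in_ball[of t] that by (simp add: closest_point_self)
  then show ?thesis
    using u by blast
qed

text \<open>A Gronwall argument: both solutions stay in one ball up to time \<open>t\<close>, where
  \<open>F\<close> has a Lipschitz constant \<open>L\<close>. The squared distance then grows at
  rate at most \<open>2 * L\<close>, so multiplying it by \<open>exp (- (2 * L) * a)\<close> makes
  it nonincreasing.\<close>

lemma ode_unique:
  fixes F :: "'a::euclidean_space \<Rightarrow> 'a"
  assumes lip: "ball_lipschitz F"
    and u: "continuous_on {0..} u" "\<And>t. 0 < t \<Longrightarrow> (u has_vector_derivative F (u t)) (at t)"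
    and v: "continuous_on {0..} v" "\<And>t. 0 < t \<Longrightarrow> (v has_vector_derivative F (v t)) (at t)"
    and "u 0 = v 0" and t: "0 \<le> t"
  shows "u t = v t"
proof -
  have ut: "continuous_on {0..t} u" and vt: "continuous_on {0..t} v"
    using u(1) v(1) by (auto intro: continuous_on_subset[of "{0..}"])
  then have "bounded (u ` {0..t})" "bounded (v ` {0..t})"
    by (auto intro!: compact_imp_bounded compact_continuous_image)
  then have "bounded (u ` {0..t} \<union> v ` {0..t})"
    by simp
  then obtain r where r: "u ` {0..t} \<union> v ` {0..t} \<subseteq> cball 0 r"
    unfolding bounded_iff subset_eq mem_cball_0 by blast
  obtain L where L: "L-lipschitz_on (cball 0 r) F"
    using ball_lipschitzD[OF lip] by blast
  define g where "g a = exp (- (2 * L) * a) * ((u a - v a) \<bullet> (u a - v a))" for a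
  have "g 0 \<ge> g t"
  proof (rule DERIV_nonpos_imp_decreasing_open[OF t])
    show "continuous_on {0..t} g"
      unfolding g_def by (intro continuous_intros ut vt)
    fix a
    assume a: "0 < a" "a < t"
    let ?d = "u a - v a" and ?D = "F (u a) - F (v a)"
    have "((\<lambda>a. u a - v a) has_derivative (\<lambda>x. x *\<^sub>R ?D)) (at a)"
      using u(2)[OF a(1)] v(2)[OF a(1)]
      by (intro derivative_eq_intros) (auto simp: has_vector_derivative_def scaleR_diff_right)
    then have "((\<lambda>a. (u a - v a) \<bullet> (u a - v a)) has_derivative
        (\<lambda>x. ?d \<bullet> (x *\<^sub>R ?D) + (x *\<^sub>R ?D) \<bullet> ?d)) (at a)"
      using has_derivative_inner by blast
    then have d: "((\<lambda>a. (u a - v a) \<bullet> (u a - v a)) has_real_derivative 2 * (?D \<bullet> ?d)) (at a)"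
      by (rule has_derivative_imp_has_field_derivative) (simp add: inner_commute)
    have "((\<lambda>a. exp (- (2 * L) * a)) has_real_derivative - (2 * L) * exp (- (2 * L) * a)) (at a)"
      by (auto intro!: derivative_eq_intros)
    from DERIV_mult[OF this d] have "(g has_real_derivative
        - (2 * L) * exp (- (2 * L) * a) * (?d \<bullet> ?d) + 2 * (?D \<bullet> ?d) * exp (- (2 * L) * a)) (at a)"
      unfolding g_def .
    moreover have "?D \<bullet> ?d \<le> L * (?d \<bullet> ?d)"
    proof -
      have "?D \<bullet> ?d \<le> norm ?D * norm ?d"
        by (rule norm_cauchy_schwarz)
      also have "\<dots> \<le> (L * norm ?d) * norm ?d"
        using r a by (intro mult_right_mono lipschitz_on_normD[OF L]) (auto simp: image_subset_iff)
      finally show ?thesis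
        by (simp add: dot_square_norm power2_eq_square)
    qed
    then have "exp (- (2 * L) * a) * (2 * (?D \<bullet> ?d)) \<le> exp (- (2 * L) * a) * (2 * (L * (?d \<bullet> ?d)))"
      by (intro mult_left_mono) auto
    ultimately show "\<exists>y. (g has_real_derivative y) (at a) \<and> y \<le> 0"
      by (intro exI conjI) (assumption, simp add: algebra_simps)
  qed
  then have "(u t - v t) \<bullet> (u t - v t) \<le> 0"
    using \<open>u 0 = v 0\<close> by (simp add: g_def mult_le_0_iff)
  then show ?thesis
    by (metis inner_gt_zero_iff not_le right_minus_eq)
qed

section \<open>Spectral theory of the graph Laplacian\<close>

context weighted_graph
begin

text \<open>Extending the weight by zero turns sums over neighbours into sums over all pairs, whose
  order can be exchanged.\<close>

definition edge_weight :: "'v \<Rightarrow> 'v \<Rightarrow> real" where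
  "edge_weight x y = (if (x, y) \<in> E then w x y else 0)"

lemma edge_weight_sym: "edge_weight x y = edge_weight y x"
  using edges_sym weight_sym by (auto simp: edge_weight_def sym_def)

lemma edge_weight_nonneg: "0 \<le> edge_weight x y"
  using weight_pos by (auto simp: edge_weight_def less_imp_le)

lemma measure_mult_laplacian:
  "\<mu> x * laplacian E w \<mu> u x = (\<Sum>y\<in>UNIV. edge_weight x y * (u y - u x))"
proof -
  have "(\<Sum>y\<in>{y. (x, y) \<in> E}. w x y * (u y - u x)) = (\<Sum>y\<in>UNIV. edge_weight x y * (u y - u x))"
    unfolding edge_weight_def by (rule sum.mono_neutral_cong_left) auto
  then show ?thesis
    using measure_pos[of x] by (simp add: laplacian_def)
qed

text \<open>Exchanging the two vertices changes the sign of each summand, so the double sum equals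
  its own negative.\<close>

lemma sum_laplacian: "(\<Sum>x\<in>UNIV. \<mu> x * laplacian E w \<mu> u x) = 0"
proof -
  let ?S = "\<Sum>x\<in>UNIV. \<Sum>y\<in>UNIV. edge_weight x y * (u y - u x)"
  have "?S = (\<Sum>x\<in>UNIV. \<Sum>y\<in>UNIV. edge_weight y x * (u x - u y))"
    by (rule sum.swap)
  also have "\<dots> = - ?S"
    unfolding sum_negf[symmetric]
    by (intro sum.cong refl) (simp add: edge_weight_sym algebra_simps)
  finally show ?thesis
    by (simp add: measure_mult_laplacian)
qed

text \<open>Summation by parts: adding the double sum to its copy with the vertices exchanged
  completes the squares.\<close>

lemma dirichlet_energy:
  "(\<Sum>x\<in>UNIV. \<mu> x * (u x * laplacian E w \<mu> u x)) =
    - (\<Sum>x\<in>UNIV. \<Sum>y\<in>UNIV. edge_weight x y * (u y - u x)\<^sup>2) / 2"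
proof -
  let ?S = "\<Sum>x\<in>UNIV. \<Sum>y\<in>UNIV. edge_weight x y * (u x * (u y - u x))"
  have "(\<Sum>x\<in>UNIV. \<mu> x * (u x * laplacian E w \<mu> u x)) = ?S"
    by (intro sum.cong refl)
      (simp add: mult.left_commute[of "\<mu> _"] measure_mult_laplacian sum_distrib_left mult_ac)
  moreover have "?S = (\<Sum>x\<in>UNIV. \<Sum>y\<in>UNIV. edge_weight y x * (u y * (u x - u y)))"
    by (rule sum.swap)
  then have "?S + ?S = (\<Sum>x\<in>UNIV. \<Sum>y\<in>UNIV.
      edge_weight x y * (u x * (u y - u x)) + edge_weight y x * (u y * (u x - u y)))"
    by (simp add: sum.distrib)
  moreover have "\<dots> = - (\<Sum>x\<in>UNIV. \<Sum>y\<in>UNIV. edge_weight x y * (u y - u x)\<^sup>2)"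
    unfolding sum_negf[symmetric]
    by (intro sum.cong refl) (simp add: edge_weight_sym power2_eq_square algebra_simps)
  ultimately show ?thesis
    by simp
qed

text \<open>The Dirichlet energy of such a function vanishes, so it agrees across every edge and
  then along every path.\<close>

lemma harmonic_imp_constant:
  assumes "\<And>x. laplacian E w \<mu> u x = 0"
  shows "u x = u y"
proof -
  have "(\<Sum>x\<in>UNIV. \<Sum>y\<in>UNIV. edge_weight x y * (u y - u x)\<^sup>2) = 0"
    using dirichlet_energy[of u] assms by simp
  then have zero: "edge_weight x y * (u y - u x)\<^sup>2 = 0" for x y
    by (simp add: sum_nonneg_eq_0_iff sum_nonneg edge_weight_nonneg)
  have edge: "u x = u y" if "(x, y) \<in> E" for x y
    using zero[of x y] weight_pos[OF that] that by (simp add: edge_weight_def)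
  show ?thesis
    using connected[of x y] by (induction rule: rtrancl_induct) (auto dest: edge)
qed

end

section \<open>Eigenfunction expansion and the fractional quadratic form\<close>

locale spectral_graph = weighted_graph E w \<mu>
  for E :: "'v::finite rel" and w \<mu> +
  fixes lam :: "nat \<Rightarrow> real" and \<phi> :: "nat \<Rightarrow> 'v \<Rightarrow> real" and s :: real
  assumes eigensystem: "laplacian_eigensystem E w \<mu> lam \<phi>"
begin

abbreviation W :: "'v \<Rightarrow> 'v \<Rightarrow> real" where
  "W \<equiv> frac_weight \<mu> lam \<phi> s"

abbreviation coef :: "('v \<Rightarrow> real) \<Rightarrow> nat \<Rightarrow> real" where
  "coef u i \<equiv> vintegral \<mu> (\<lambda>x. u x * \<phi> i x)"

lemma eigenfunction:
  "i < CARD('v) \<Longrightarrow> laplacian E w \<mu> (\<phi> i) x = - (lam i * \<phi> i x)"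
  using eigensystem unfolding laplacian_eigensystem_def by (metis minus_equation_iff)

lemma orthonormal:
  "i < CARD('v) \<Longrightarrow> j < CARD('v) \<Longrightarrow>
    vintegral \<mu> (\<lambda>x. \<phi> i x * \<phi> j x) = (if i = j then 1 else 0)"
  using eigensystem by (simp add: laplacian_eigensystem_def)

text \<open>Integrate the eigenvalue equation: the Laplacian has zero mean.\<close>

lemma sum_eigenfunction:
  assumes "i < CARD('v)" and "lam i \<noteq> 0"
  shows "(\<Sum>x\<in>UNIV. \<mu> x * \<phi> i x) = 0"
proof -
  have "lam i * (\<Sum>x\<in>UNIV. \<mu> x * \<phi> i x) = 0"
    using sum_laplacian[of "\<phi> i"]
    by (simp add: eigenfunction assms sum_distrib_left sum_negf mult.left_commute)
  then show ?thesis
    using assms by simp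
qed

lemma eigenfunction_zero_constant:
  "i < CARD('v) \<Longrightarrow> lam i = 0 \<Longrightarrow> \<phi> i x = \<phi> i y"
  by (rule harmonic_imp_constant) (simp add: eigenfunction)

text \<open>Scaling by \<open>sqrt (\<mu> x)\<close> turns the weighted inner product into the
  Euclidean one. The scaled eigenfunctions are then orthonormal and as many as the dimension, hence
  a basis.\<close>

lemma eigenfunction_expansion: "u x = (\<Sum>i<CARD('v). coef u i * \<phi> i x)"
proof -
  define e :: "nat \<Rightarrow> real ^ 'v" where "e i = (\<chi> x. sqrt (\<mu> x) * \<phi> i x)" for i
  define U :: "real ^ 'v" where "U = (\<chi> x. sqrt (\<mu> x) * u x)"
  have sq: "sqrt (\<mu> x) * a * (sqrt (\<mu> x) * b) = \<mu> x * (a * b)" for x a b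
    using measure_pos[of x] by (simp add: mult.assoc mult.left_commute[of a])
  have ip: "e i \<bullet> e j = (if i = j then 1 else 0)" if "i < CARD('v)" "j < CARD('v)" for i j
    using orthonormal[OF that] by (simp add: e_def inner_vec_def vintegral_def sq)
  have inj: "inj_on e {..<CARD('v)}"
  proof (rule inj_onI)
    fix i j
    assume "i \<in> {..<CARD('v)}" "j \<in> {..<CARD('v)}" "e i = e j"
    then show "i = j"
      using ip[of i i] ip[of i j] by (auto split: if_splits)
  qed
  let ?B = "e ` {..<CARD('v)}"
  have orth: "pairwise orthogonal ?B"
    unfolding pairwise_def orthogonal_def using ip by fastforce
  have norm1: "norm b = 1" if "b \<in> ?B" for b
    using that ip by (auto simp: norm_eq_1)
  have "independent ?B"
    using orth norm1 by (intro pairwise_orthogonal_independent) fastforce+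
  then have "UNIV \<subseteq> span ?B"
    using inj by (intro card_ge_dim_independent) (auto simp: card_image)
  then have "(\<Sum>b\<in>?B. (U \<bullet> b) *\<^sub>R b) = U"
    using orth norm1 by (intro orthonormal_basis_expand) auto
  then have "(\<Sum>i<CARD('v). (U \<bullet> e i) *\<^sub>R e i) = U"
    by (simp add: sum.reindex[OF inj])
  then have "(\<Sum>i<CARD('v). (U \<bullet> e i) *\<^sub>R e i) $ x = U $ x"
    by simp
  moreover have "U \<bullet> e i = coef u i" for i
    by (simp add: U_def e_def inner_vec_def vintegral_def sq)
  ultimately have "sqrt (\<mu> x) * (\<Sum>i<CARD('v). coef u i * \<phi> i x) = sqrt (\<mu> x) * u x"
    by (simp add: U_def e_def sum_distrib_left mult.left_commute)
  then show ?thesis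
    using measure_pos[of x] by simp
qed

lemma frac_weight_sym: "W x y = W y x"
  by (simp add: frac_weight_def mult_ac)

text \<open>The diagonal value given by the same formula is included. Each term contains the mean of
  an eigenfunction, which vanishes unless \<open>lam i = 0\<close>, and then
  \<open>0 powr s = 0\<close>.\<close>

lemma sum_frac_weight: "(\<Sum>y\<in>UNIV. W x y) = 0"
proof -
  have "(\<Sum>y\<in>UNIV. W x y) =
      - \<mu> x * (\<Sum>i<CARD('v). lam i powr s * \<phi> i x * (\<Sum>y\<in>UNIV. \<mu> y * \<phi> i y))"
    unfolding frac_weight_def sum_distrib_left
    by (subst sum.swap) (intro sum.cong refl, simp add: mult_ac)
  also have "(\<Sum>i<CARD('v). lam i powr s * \<phi> i x * (\<Sum>y\<in>UNIV. \<mu> y * \<phi> i y)) = 0"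
    using sum_eigenfunction by (intro sum.neutral) fastforce
  finally show ?thesis
    by simp
qed

text \<open>The diagonal term can be added because \<open>u x - u x = 0\<close>; the vanishing row
  sums then remove the part with \<open>u x\<close>, leaving a plain matrix action.\<close>

lemma measure_mult_frac_laplacian:
  "\<mu> x * frac_laplacian \<mu> lam \<phi> s u x = - (\<Sum>y\<in>UNIV. W x y * u y)"
proof -
  have "\<mu> x * frac_laplacian \<mu> lam \<phi> s u x = (\<Sum>y\<in>UNIV - {x}. W x y * (u x - u y))"
    using measure_pos[of x] by (simp add: frac_laplacian_def)
  also have "\<dots> = (\<Sum>y\<in>UNIV. W x y * (u x - u y))"
    by (rule sum.mono_neutral_left) auto
  also have "\<dots> = (\<Sum>y\<in>UNIV. W x y) * u x - (\<Sum>y\<in>UNIV. W x y * u y)"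
    by (simp add: right_diff_distrib sum_subtractf sum_distrib_right)
  finally show ?thesis
    by (simp add: sum_frac_weight)
qed

text \<open>This is the integral of \<open>u\<close> times its fractional Laplacian, or equally the
  integral of \<open>frac_grad_sq\<close>, rewritten by means of the vanishing row sums.\<close>

definition frac_form :: "('v \<Rightarrow> real) \<Rightarrow> real" where
  "frac_form u = - (\<Sum>x\<in>UNIV. \<Sum>y\<in>UNIV. W x y * u x * u y)"

text \<open>For each eigenfunction the double sum over vertices factors into a square, so the form
  is diagonal in the spectral coefficients and visibly nonnegative.\<close>

lemma frac_form_spectral: "frac_form u = (\<Sum>i<CARD('v). lam i powr s * (coef u i)\<^sup>2)"
proof -
  have "frac_form u = (\<Sum>x\<in>UNIV. \<Sum>y\<in>UNIV. \<Sum>i<CARD('v).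
      lam i powr s * ((\<mu> x * (u x * \<phi> i x)) * (\<mu> y * (u y * \<phi> i y))))"
    unfolding frac_form_def frac_weight_def sum_negf[symmetric] sum_distrib_left sum_distrib_right
    by (intro sum.cong refl) (simp add: mult_ac)
  also have "\<dots> = (\<Sum>x\<in>UNIV. \<Sum>i<CARD('v). \<Sum>y\<in>UNIV.
      lam i powr s * ((\<mu> x * (u x * \<phi> i x)) * (\<mu> y * (u y * \<phi> i y))))"
    by (intro sum.cong refl sum.swap)
  also have "\<dots> = (\<Sum>i<CARD('v). \<Sum>x\<in>UNIV. \<Sum>y\<in>UNIV.
      lam i powr s * ((\<mu> x * (u x * \<phi> i x)) * (\<mu> y * (u y * \<phi> i y))))"
    by (rule sum.swap)
  also have "\<dots> = (\<Sum>i<CARD('v). lam i powr s * (coef u i)\<^sup>2)"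
    by (simp only: vintegral_def power2_eq_square sum_product) (simp only: sum_distrib_left)
  finally show ?thesis .
qed

lemma frac_form_nonneg: "0 \<le> frac_form u"
  by (simp add: frac_form_spectral sum_nonneg)

text \<open>
  Eigenfunctions for the eigenvalue zero are constant and drop out of differences; this replaces
  the positivity of the fractional weights.
\<close>

lemma oscillation_le_frac_form:
  "\<exists>C\<ge>0. \<forall>u x z. \<bar>u x - u z\<bar> \<le> C * sqrt (frac_form u)"
proof -
  define K where "K x z i = \<bar>\<phi> i x - \<phi> i z\<bar> / sqrt (lam i powr s)" for x z i
  \<comment> \<open>Summing over all pairs of vertices gives one constant that serves every
    pair.\<close>
  define C where "C = (\<Sum>x\<in>UNIV. \<Sum>z\<in>UNIV. \<Sum>i<CARD('v). K x z i)"
  have K: "0 \<le> K x z i" for x z i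
    by (simp add: K_def)
  have "\<bar>u x - u z\<bar> \<le> C * sqrt (frac_form u)" for u x z
  proof -
    have bound: "\<bar>coef u i * (\<phi> i x - \<phi> i z)\<bar> \<le> K x z i * sqrt (frac_form u)"
      if i: "i < CARD('v)" for i
    proof (cases "lam i = 0")
      case True
      then show ?thesis
        using eigenfunction_zero_constant[OF i True, of x z] K frac_form_nonneg by simp
    next
      \<comment> \<open>At a nonzero base \<open>powr\<close> is an exponential, hence positive
        whatever the sign of the base.\<close>
      case False
      then have pos: "0 < lam i powr s"
        by simp
      have "lam i powr s * (coef u i)\<^sup>2 \<le> frac_form u"
        unfolding frac_form_spectral using i by (intro member_le_sum) auto
      then have "sqrt (lam i powr s * (coef u i)\<^sup>2) \<le> sqrt (frac_form u)"
        by (rule real_sqrt_le_mono)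
      then have "\<bar>coef u i\<bar> \<le> sqrt (frac_form u) / sqrt (lam i powr s)"
        using pos by (simp add: real_sqrt_mult pos_le_divide_eq mult.commute)
      then have "\<bar>coef u i\<bar> * \<bar>\<phi> i x - \<phi> i z\<bar>
          \<le> sqrt (frac_form u) / sqrt (lam i powr s) * \<bar>\<phi> i x - \<phi> i z\<bar>"
        by (rule mult_right_mono) simp
      then show ?thesis
        by (simp add: K_def abs_mult mult_ac)
    qed
    have "u x - u z = (\<Sum>i<CARD('v). coef u i * (\<phi> i x - \<phi> i z))"
      by (subst (1 2) eigenfunction_expansion) (simp add: right_diff_distrib sum_subtractf)
    then have "\<bar>u x - u z\<bar> \<le> (\<Sum>i<CARD('v). \<bar>coef u i * (\<phi> i x - \<phi> i z)\<bar>)"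
      by simp
    also have "\<dots> \<le> (\<Sum>i<CARD('v). K x z i * sqrt (frac_form u))"
      using bound by (intro sum_mono) auto
    also have "\<dots> = (\<Sum>i<CARD('v). K x z i) * sqrt (frac_form u)"
      by (simp add: sum_distrib_right)
    also have "\<dots> \<le> C * sqrt (frac_form u)"
    proof (rule mult_right_mono)
      have "(\<Sum>i<CARD('v). K x z i) \<le> (\<Sum>z\<in>UNIV. \<Sum>i<CARD('v). K x z i)"
        by (rule member_le_sum) (auto simp: K sum_nonneg)
      also have "\<dots> \<le> C"
        unfolding C_def by (rule member_le_sum) (auto simp: K sum_nonneg)
      finally show "(\<Sum>i<CARD('v). K x z i) \<le> C" .
    qed (simp add: frac_form_nonneg)
    finally show ?thesis .
  qed
  moreover have "0 \<le> C"
    by (simp add: C_def K sum_nonneg)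
  ultimately show ?thesis
    by blast
qed

end

section \<open>Energy estimates\<close>

locale mean_field_flow = spectral_graph E w \<mu> lam \<phi> s
  for E :: "'v::finite rel" and w \<mu> lam \<phi> s +
  fixes \<rho> :: real and h :: "'v \<Rightarrow> real"
  assumes \<rho>_pos: "0 < \<rho>" and h_nonzero: "\<exists>x. h x \<noteq> 0"
begin

abbreviation L :: "('v \<Rightarrow> real) \<Rightarrow> 'v \<Rightarrow> real" where
  "L \<equiv> frac_laplacian \<mu> lam \<phi> s"

abbreviation R :: "('v \<Rightarrow> real) \<Rightarrow> 'v \<Rightarrow> real" where
  "R \<equiv> flow_R \<mu> lam \<phi> s \<rho>"

abbreviation \<alpha> :: "('v \<Rightarrow> real) \<Rightarrow> real" where
  "\<alpha> \<equiv> flow_alpha \<mu> lam \<phi> s \<rho> h"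

definition velocity :: "('v \<Rightarrow> real) \<Rightarrow> 'v \<Rightarrow> real" where
  "velocity u x = \<alpha> u * h x - R u x"

definition mass :: "('v \<Rightarrow> real) \<Rightarrow> real" where
  "mass u = vintegral \<mu> (\<lambda>x. h x * exp (u x))"

text \<open>The variational functional of the mean field equation; its remaining term
  \<open>- \<rho> * ln (mass u)\<close> vanishes on the constraint set.\<close>

definition energy :: "('v \<Rightarrow> real) \<Rightarrow> real" where
  "energy u = frac_form u / 2 + \<rho> / volume \<mu> * (\<Sum>x\<in>UNIV. \<mu> x * u x)"

text \<open>The squared length of the velocity for the inner product with weights
  \<open>\<mu> x * exp (u x)\<close>. In this metric the flow is, up to the factor
  \<open>\<rho>\<close>, the descending gradient flow of the energy projected onto the
  constraint.\<close>

definition dissipation :: "('v \<Rightarrow> real) \<Rightarrow> real" where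
  "dissipation u = (\<Sum>x\<in>UNIV. \<mu> x * exp (u x) * (velocity u x)\<^sup>2)"

lemma mem_constraint_set_iff: "u \<in> constraint_set \<mu> lam \<phi> s h \<longleftrightarrow> mass u = 1"
  by (simp add: constraint_set_def mass_def frac_sobolev_eq_UNIV)

lemma volume_pos: "0 < volume \<mu>"
  unfolding volume_def using measure_pos by (intro sum_pos) auto

lemma weighted_h_sq_pos: "0 < vintegral \<mu> (\<lambda>x. (h x)\<^sup>2 * exp (u x))"
proof -
  obtain x where "h x \<noteq> 0"
    using h_nonzero by blast
  then have "0 < \<mu> x * ((h x)\<^sup>2 * exp (u x))"
    using measure_pos[of x] by simp
  also have "\<dots> \<le> vintegral \<mu> (\<lambda>x. (h x)\<^sup>2 * exp (u x))"
    unfolding vintegral_def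
    by (intro member_le_sum) (auto intro!: mult_nonneg_nonneg less_imp_le[OF measure_pos])
  finally show ?thesis .
qed

text \<open>\<open>\<alpha> u\<close> is exactly the coefficient that makes the velocity orthogonal
  to \<open>h\<close> in the metric weighted by \<open>exp (u x)\<close>, that is, tangent to the
  level sets of \<open>mass\<close>.\<close>

lemma velocity_orthogonal: "(\<Sum>x\<in>UNIV. \<mu> x * (h x * exp (u x) * velocity u x)) = 0"
proof -
  have "(\<Sum>x\<in>UNIV. \<mu> x * (h x * exp (u x) * velocity u x)) =
      \<alpha> u * vintegral \<mu> (\<lambda>x. (h x)\<^sup>2 * exp (u x)) - vintegral \<mu> (\<lambda>x. h x * R u x * exp (u x))"
    unfolding velocity_def vintegral_def sum_distrib_left sum_subtractf[symmetric]
    by (intro sum.cong refl) (simp add: power2_eq_square algebra_simps)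
  then show ?thesis
    using weighted_h_sq_pos[of u] by (simp add: flow_alpha_def)
qed

text \<open>The right side is the partial derivative of the energy in the coordinate
  \<open>u x\<close>, so \<open>\<rho> * R u\<close> is its gradient in the weighted metric.\<close>

lemma energy_gradient:
  "\<rho> * (\<mu> x * exp (u x) * R u x) = - (\<Sum>y\<in>UNIV. W x y * u y) + \<mu> x * (\<rho> / volume \<mu>)"
proof -
  have "\<rho> * (\<mu> x * exp (u x) * R u x) = \<mu> x * L u x + \<mu> x * (\<rho> / volume \<mu>)"
    using \<rho>_pos by (simp add: flow_R_def exp_minus field_simps)
  then show ?thesis
    by (simp add: measure_mult_frac_laplacian)
qed

lemma mass_deriv:
  assumes "\<And>x. (u x has_real_derivative velocity (\<lambda>y. u y t) x) (at t)"
  shows "((\<lambda>t. mass (\<lambda>x. u x t)) has_real_derivative 0) (at t)"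
proof -
  have "((\<lambda>t. mass (\<lambda>x. u x t)) has_real_derivative
      (\<Sum>x\<in>UNIV. \<mu> x * (h x * exp (u x t) * velocity (\<lambda>y. u y t) x))) (at t)"
    unfolding mass_def vintegral_def using assms
    by (auto intro!: derivative_eq_intros sum.cong simp: mult_ac)
  then show ?thesis
    by (simp add: velocity_orthogonal)
qed

text \<open>Pair the gradient with the velocity and write \<open>R\<close> as
  \<open>\<alpha> u * h x\<close> minus the velocity. The part with \<open>h\<close> drops out by
  orthogonality and the rest is the dissipation.\<close>

lemma energy_deriv:
  assumes u': "\<And>x. (u x has_real_derivative velocity (\<lambda>y. u y t) x) (at t)"
  shows "((\<lambda>t. energy (\<lambda>x. u x t)) has_real_derivative - \<rho> * dissipation (\<lambda>x. u x t)) (at t)"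
proof -
  define a where "a x = u x t" for x
  define v where "v = velocity a"
  have a: "(\<lambda>x. u x t) = a"
    by (rule ext) (simp add: a_def)
  let ?S = "\<Sum>x\<in>UNIV. \<Sum>y\<in>UNIV. W x y * (v x * a y)"
  have "((\<lambda>t. energy (\<lambda>x. u x t)) has_real_derivative
      - (\<Sum>x\<in>UNIV. \<Sum>y\<in>UNIV. W x y * (v x * a y) + W x y * (a x * v y)) / 2
      + \<rho> / volume \<mu> * (\<Sum>x\<in>UNIV. \<mu> x * v x)) (at t)"
    unfolding energy_def frac_form_def using u' volume_pos
    by (auto intro!: derivative_eq_intros sum.cong simp: a v_def a_def[symmetric] mult_ac add_ac)
  also have "(\<Sum>x\<in>UNIV. \<Sum>y\<in>UNIV. W x y * (v x * a y) + W x y * (a x * v y)) =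
      ?S + (\<Sum>x\<in>UNIV. \<Sum>y\<in>UNIV. W x y * (a x * v y))"
    by (simp add: sum.distrib)
  also have "(\<Sum>x\<in>UNIV. \<Sum>y\<in>UNIV. W x y * (a x * v y)) = ?S"
    by (subst sum.swap) (simp add: frac_weight_sym mult_ac)
  also have "- (?S + ?S) / 2 + \<rho> / volume \<mu> * (\<Sum>x\<in>UNIV. \<mu> x * v x) =
      (\<Sum>x\<in>UNIV. v x * (- (\<Sum>y\<in>UNIV. W x y * a y) + \<mu> x * (\<rho> / volume \<mu>)))"
    by (simp add: sum_distrib_left sum_subtractf algebra_simps)
  also have "\<dots> = (\<Sum>x\<in>UNIV. v x * (\<rho> * (\<mu> x * exp (a x) * R a x)))"
    by (simp add: energy_gradient)
  also have "\<dots> = \<rho> * \<alpha> a * (\<Sum>x\<in>UNIV. \<mu> x * (h x * exp (a x) * velocity a x))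
      - \<rho> * dissipation a"
    unfolding dissipation_def sum_distrib_left sum_subtractf[symmetric]
    by (intro sum.cong refl) (simp add: v_def velocity_def power2_eq_square algebra_simps)
  finally show ?thesis
    by (simp add: a velocity_orthogonal)
qed

lemma dissipation_nonneg: "0 \<le> dissipation u"
  unfolding dissipation_def by (intro sum_nonneg mult_nonneg_nonneg less_imp_le[OF measure_pos]) auto

lemma dissipation_eq_0_iff: "dissipation u = 0 \<longleftrightarrow> (\<forall>x. velocity u x = 0)"
proof -
  have "0 \<le> \<mu> x * exp (u x) * (velocity u x)\<^sup>2" for x
    using measure_pos[of x] by simp
  moreover have "\<mu> x \<noteq> 0" for x
    using measure_pos[of x] by simp
  ultimately show ?thesis
    by (simp add: dissipation_def sum_nonneg_eq_0_iff)
qed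

text \<open>
  The constraint bounds the maximum of \<open>u\<close> from below and the oscillation of \<open>u\<close> is controlled by
  the square root \<open>q\<close> of the quadratic part, so the energy grows at least like \<open>q\<^sup>2 / 2 - C \<rho> q\<close>.
\<close>

lemma mass_one_bounds:
  "\<exists>C\<ge>0. \<exists>k. \<forall>u. mass u = 1 \<longrightarrow> (\<exists>z. - k \<le> u z \<and> (\<forall>x. \<bar>u x - u z\<bar> \<le> C * sqrt (frac_form u)) \<and>
      (sqrt (frac_form u))\<^sup>2 / 2 + \<rho> * (u z - C * sqrt (frac_form u)) \<le> energy u)"
proof -
  obtain C where C: "0 \<le> C" "\<And>u x z. \<bar>u x - u z\<bar> \<le> C * sqrt (frac_form u)"
    using oscillation_le_frac_form by blast
  define H where "H = (\<Sum>x\<in>UNIV. \<mu> x * \<bar>h x\<bar>)"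
  have "\<exists>z. - ln H \<le> u z \<and> (\<forall>x. \<bar>u x - u z\<bar> \<le> C * sqrt (frac_form u)) \<and>
      (sqrt (frac_form u))\<^sup>2 / 2 + \<rho> * (u z - C * sqrt (frac_form u)) \<le> energy u"
    if u: "mass u = 1" for u
  proof -
    \<comment> \<open>The vertex \<open>z\<close> is a maximum point; replacing every value by
      \<open>u z\<close> in the constraint gives \<open>1 \<le> exp (u z) * H\<close>.\<close>
    have "Max (range u) \<in> range u"
      by (rule Max_in) auto
    then obtain z where "u z = Max (range u)"
      by (metis imageE)
    then have z: "u x \<le> u z" for x
      by simp
    have "1 \<le> (\<Sum>x\<in>UNIV. \<mu> x * (\<bar>h x\<bar> * exp (u z)))"
      unfolding u[symmetric] mass_def vintegral_def
      using z by (intro sum_mono mult_left_mono mult_mono less_imp_le[OF measure_pos]) auto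
    also have "\<dots> = exp (u z) * H"
      by (simp add: H_def sum_distrib_left mult_ac)
    finally have *: "1 \<le> exp (u z) * H" .
    then have "0 < H"
      by (metis exp_gt_zero less_le_trans zero_less_mult_pos zero_less_one)
    have "0 \<le> ln (exp (u z) * H)"
      using * by (rule ln_ge_zero)
    then have "- ln H \<le> u z"
      using \<open>0 < H\<close> by (simp add: ln_mult)
    moreover have "\<forall>x. \<bar>u x - u z\<bar> \<le> C * sqrt (frac_form u)"
      using C(2) by blast
    moreover have "(sqrt (frac_form u))\<^sup>2 / 2 + \<rho> * (u z - C * sqrt (frac_form u)) \<le> energy u"
    proof -
      \<comment> \<open>The mean of \<open>u\<close> is at least its maximum minus the bound on its
        oscillation.\<close>
      have "volume \<mu> * (u z - C * sqrt (frac_form u)) \<le> (\<Sum>x\<in>UNIV. \<mu> x * u x)"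
        unfolding volume_def sum_distrib_right
      proof (intro sum_mono mult_left_mono less_imp_le[OF measure_pos])
        show "u z - C * sqrt (frac_form u) \<le> u x" for x
          using C(2)[where u = u and x = x and z = z] by linarith
      qed
      then have "\<rho> / volume \<mu> * (volume \<mu> * (u z - C * sqrt (frac_form u)))
          \<le> \<rho> / volume \<mu> * (\<Sum>x\<in>UNIV. \<mu> x * u x)"
        using \<rho>_pos volume_pos by (intro mult_left_mono) auto
      then show ?thesis
        using volume_pos frac_form_nonneg[of u] by (simp add: energy_def)
    qed
    ultimately show ?thesis
      by blast
  qed
  then show ?thesis
    using C(1) by blast
qed

text \<open>Completing the square: \<open>q\<^sup>2 / 2 - \<rho> * C * q\<close> is at least
  \<open>- (\<rho> * C)\<^sup>2 / 2\<close>, and the maximum of \<open>u\<close> is at least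
  \<open>- k\<close>.\<close>

lemma energy_bounded_below: "\<exists>m. \<forall>u. mass u = 1 \<longrightarrow> m \<le> energy u"
proof -
  obtain C k where C: "0 \<le> C" and Ck: "\<And>u. mass u = 1 \<Longrightarrow>
      \<exists>z. - k \<le> u z \<and> (\<forall>x. \<bar>u x - u z\<bar> \<le> C * sqrt (frac_form u)) \<and>
      (sqrt (frac_form u))\<^sup>2 / 2 + \<rho> * (u z - C * sqrt (frac_form u)) \<le> energy u"
    using mass_one_bounds by blast
  have "- \<rho> * k - (\<rho> * C)\<^sup>2 / 2 \<le> energy u" if u: "mass u = 1" for u
  proof -
    define q where "q = sqrt (frac_form u)"
    obtain z where z: "- k \<le> u z" "q\<^sup>2 / 2 + \<rho> * (u z - C * q) \<le> energy u"
      using Ck[OF u] q_def by blast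
    have "\<rho> * - k \<le> \<rho> * u z"
      using z \<rho>_pos by (intro mult_left_mono) auto
    moreover have "0 \<le> (q - \<rho> * C)\<^sup>2"
      by simp
    ultimately show ?thesis
      using z(2) by (simp add: power2_diff algebra_simps)
  qed
  then show ?thesis
    by blast
qed

text \<open>The energy bound gives a quadratic inequality that bounds \<open>q\<close>. It then also
  bounds \<open>u z\<close> from above, and the oscillation estimate passes both bounds on to all
  vertices.\<close>

lemma sublevel_bounded: "\<exists>r. \<forall>u. mass u = 1 \<longrightarrow> energy u \<le> J \<longrightarrow> (\<forall>x. \<bar>u x\<bar> \<le> r)"
proof -
  obtain C k where C: "0 \<le> C" and Ck: "\<And>u. mass u = 1 \<Longrightarrow>
      \<exists>z. - k \<le> u z \<and> (\<forall>x. \<bar>u x - u z\<bar> \<le> C * sqrt (frac_form u)) \<and>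
      (sqrt (frac_form u))\<^sup>2 / 2 + \<rho> * (u z - C * sqrt (frac_form u)) \<le> energy u"
    using mass_one_bounds by blast
  define b where "b = \<bar>J + \<rho> * k\<bar>"
  have b: "0 \<le> b" "J + \<rho> * k \<le> b"
    by (simp_all add: b_def)
  \<comment> \<open>If \<open>1 < q\<close>, then \<open>2 * b \<le> 2 * b * q\<close>, and the
    quadratic inequality can be divided by \<open>q\<close>; the summand 1 covers
    \<open>q \<le> 1\<close>.\<close>
  define q0 where "q0 = 1 + 2 * \<rho> * C + 2 * b"
  \<comment> \<open>One \<open>C * q0\<close> comes from the upper bound
    \<open>J / \<rho> + C * q\<close> on \<open>u z\<close>, the other from the distance between
    \<open>u x\<close> and \<open>u z\<close>.\<close>
  define r where "r = \<bar>k\<bar> + \<bar>J\<bar> / \<rho> + 2 * C * q0"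
  have "\<bar>u x\<bar> \<le> r" if u: "mass u = 1" "energy u \<le> J" for u x
  proof -
    define q where "q = sqrt (frac_form u)"
    obtain z where z: "- k \<le> u z" "\<And>x. \<bar>u x - u z\<bar> \<le> C * q"
      "q\<^sup>2 / 2 + \<rho> * (u z - C * q) \<le> energy u"
      using Ck[OF u(1)] q_def by blast
    have q: "0 \<le> q"
      by (simp add: q_def frac_form_nonneg)
    have "\<rho> * - k \<le> \<rho> * u z"
      using z \<rho>_pos by (intro mult_left_mono) auto
    then have "q * q \<le> 2 * \<rho> * C * q + 2 * (J + \<rho> * k)"
      using z(3) u(2) by (simp add: power2_eq_square algebra_simps)
    also have "\<dots> \<le> 2 * \<rho> * C * q + 2 * b"
      using b by (intro add_left_mono mult_left_mono) auto
    finally have quad: "q * q \<le> 2 * \<rho> * C * q + 2 * b" .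
    have "q \<le> q0"
    proof (cases "q \<le> 1")
      case True
      then show ?thesis
        using C \<rho>_pos b by (simp add: q0_def add_nonneg_nonneg add_increasing2)
    next
      case False
      have "2 * b * 1 \<le> 2 * b * q"
        using False b by (intro mult_left_mono) auto
      then have "q * q \<le> (2 * \<rho> * C + 2 * b) * q"
        using quad by (simp add: algebra_simps)
      then show ?thesis
        using False by (simp add: q0_def)
    qed
    then have Cq: "C * q \<le> C * q0"
      using C by (rule mult_left_mono)
    have "\<rho> * (u z - C * q) \<le> J"
      using z(3) u(2) zero_le_power2[of q] by linarith
    then have "u z - C * q \<le> J / \<rho>"
      using \<rho>_pos by (simp add: pos_le_divide_eq mult.commute)
    moreover have "J / \<rho> \<le> \<bar>J\<bar> / \<rho>"
      using \<rho>_pos by (intro divide_right_mono) auto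
    moreover have "0 \<le> \<bar>J\<bar> / \<rho>" "0 \<le> C * q0"
      using \<rho>_pos C q \<open>q \<le> q0\<close> by auto
    ultimately show ?thesis
      unfolding r_def using z(1) z(2)[of x] Cq by linarith
  qed
  then show ?thesis
    by blast
qed

section \<open>The flow\<close>

definition field :: "real ^ 'v \<Rightarrow> real ^ 'v" where
  "field U = (\<chi> x. velocity (($) U) x)"

text \<open>The velocity is built from coordinates by sums, products, exponentials and one quotient,
  the denominator of \<open>\<alpha>\<close> being positive.\<close>

lemma ball_lipschitz_field: "ball_lipschitz field"
proof -
  have R: "ball_lipschitz (\<lambda>U :: real ^ 'v. R (($) U) x)" for x
    unfolding flow_R_def frac_laplacian_def by (intro ball_lipschitz_intros)
  have "ball_lipschitz (\<lambda>U :: real ^ 'v. vintegral \<mu> (\<lambda>x. h x * R (($) U) x * exp (U $ x)))"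
    unfolding vintegral_def by (intro ball_lipschitz_intros R)
  moreover have "ball_lipschitz (\<lambda>U :: real ^ 'v. vintegral \<mu> (\<lambda>x. (h x)\<^sup>2 * exp (U $ x)))"
    unfolding vintegral_def by (intro ball_lipschitz_intros)
  ultimately have \<alpha>: "ball_lipschitz (\<lambda>U :: real ^ 'v. \<alpha> (($) U))"
    unfolding flow_alpha_def by (rule ball_lipschitz_divide) (rule weighted_h_sq_pos)
  show ?thesis
    unfolding field_def velocity_def
    by (intro ball_lipschitz_vec_lambda ball_lipschitz_intros R \<alpha>)
qed

section \<open>Passage between families of real functions and curves in Euclidean space\<close>

lemma solves_flow_vec:
  assumes "solves_flow \<mu> lam \<phi> s \<rho> h u0 u"
  shows "(\<chi> x. u x 0) = (\<chi> x. u0 x)" and "continuous_on {0..} (\<lambda>t. \<chi> x. u x t)"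
    and "0 < t \<Longrightarrow> ((\<lambda>t. \<chi> x. u x t) has_vector_derivative field (\<chi> x. u x t)) (at t)"
proof -
  show "(\<chi> x. u x 0) = (\<chi> x. u0 x)"
    using assms by (simp add: solves_flow_def)
  show "continuous_on {0..} (\<lambda>t. \<chi> x. u x t)"
    using assms by (intro continuous_on_vec_lambda) (simp add: solves_flow_def)
  show "((\<lambda>t. \<chi> x. u x t) has_vector_derivative field (\<chi> x. u x t)) (at t)" if "0 < t"
    unfolding field_def
    by (rule has_vector_derivative_vec_lambda)
      (use assms that in \<open>simp add: solves_flow_def velocity_def vec_lambda_inverse\<close>)
qed

lemma solves_flow_of_vec:
  assumes "U 0 = (\<chi> x. u0 x)" and "continuous_on {0..} U"
    and "\<And>t. 0 < t \<Longrightarrow> (U has_vector_derivative field (U t)) (at t)"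
  shows "solves_flow \<mu> lam \<phi> s \<rho> h u0 (\<lambda>x t. U t $ x)"
  unfolding solves_flow_def
proof (intro conjI allI impI)
  show "U 0 $ x = u0 x" for x
    by (simp add: assms)
  show "continuous_on {0..} (\<lambda>t. U t $ x)" for x
    by (intro continuous_intros assms)
  show "((\<lambda>t. U t $ x) has_real_derivative \<alpha> (($) (U t)) * h x - R (($) (U t)) x) (at t)"
    if "0 < t" for x t
    using bounded_linear.has_vector_derivative[OF bounded_linear_vec_nth[of x] assms(3)[OF that]]
    by (simp add: has_real_derivative_iff_has_vector_derivative field_def velocity_def)
qed

lemma nth_has_real_derivative:
  assumes "(U has_vector_derivative field (U t)) (at t)"
  shows "((\<lambda>t. U t $ x) has_real_derivative velocity (\<lambda>y. U t $ y) x) (at t)"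
  using bounded_linear.has_vector_derivative[OF bounded_linear_vec_nth[of x] assms]
  by (simp add: has_real_derivative_iff_has_vector_derivative field_def)

lemma continuous_on_mass:
  assumes "continuous_on S U"
  shows "continuous_on S (\<lambda>t. mass (($) (U t)))"
  unfolding mass_def vintegral_def by (intro continuous_intros assms)

lemma continuous_on_energy:
  assumes "continuous_on S U"
  shows "continuous_on S (\<lambda>t. energy (($) (U t)))"
  unfolding energy_def frac_form_def by (intro continuous_intros assms) auto

lemma continuous_on_dissipation: "continuous_on S (\<lambda>U :: real ^ 'v. dissipation (($) U))"
proof -
  \<comment> \<open>Written through \<open>field\<close>, the velocity inherits continuity from the
    Lipschitz property.\<close>
  have "dissipation (($) U) = (\<Sum>x\<in>UNIV. \<mu> x * exp (U $ x) * (field U $ x)\<^sup>2)" for U :: "real ^ 'v"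
    by (simp add: dissipation_def field_def)
  then show ?thesis
    by (simp only:)
      (intro continuous_intros ball_lipschitz_continuous_on[OF ball_lipschitz_field])
qed

text \<open>Continuity at the endpoints and the equation strictly between them suffice. This form
  fits both the a priori bound of \<open>ode_global_exists\<close> and intervals starting at time
  0.\<close>

lemma flow_conserves_mass_and_decreases_energy:
  assumes ab: "0 \<le> a" "a \<le> b" and U: "continuous_on {a..b} U"
    and U': "\<And>t. a < t \<Longrightarrow> t < b \<Longrightarrow> (U has_vector_derivative field (U t)) (at t)"
  shows "mass (($) (U b)) = mass (($) (U a))" and "energy (($) (U b)) \<le> energy (($) (U a))"
proof -
  show "energy (($) (U b)) \<le> energy (($) (U a))"
  proof (rule DERIV_nonpos_imp_decreasing_open[OF ab(2)])
    show "continuous_on {a..b} (\<lambda>t. energy (($) (U t)))"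
      using U by (rule continuous_on_energy)
    show "\<exists>y. ((\<lambda>t. energy (($) (U t))) has_real_derivative y) (at t) \<and> y \<le> 0"
      if "a < t" "t < b" for t
    proof (intro exI conjI)
      show "((\<lambda>t. energy (($) (U t))) has_real_derivative - \<rho> * dissipation (($) (U t))) (at t)"
        using U'[OF that] by (intro energy_deriv nth_has_real_derivative)
      show "- \<rho> * dissipation (($) (U t)) \<le> 0"
        using \<rho>_pos dissipation_nonneg[of "($) (U t)"] by simp
    qed
  qed
  show "mass (($) (U b)) = mass (($) (U a))"
  proof (cases "a = b")
    case False
    then show ?thesis
      using ab U U'
      by (intro DERIV_isconst_end[of a b "\<lambda>t. mass (($) (U t))"] continuous_on_mass mass_deriv
          nth_has_real_derivative) auto
  qed simp
qed

lemma flow_exists: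
  assumes "mass u0 = 1"
  shows "\<exists>u. solves_flow \<mu> lam \<phi> s \<rho> h u0 u"
proof -
  define U0 where "U0 = (\<chi> x. u0 x)"
  obtain r where r: "\<And>u x. mass u = 1 \<Longrightarrow> energy u \<le> energy u0 \<Longrightarrow> \<bar>u x\<bar> \<le> r"
    using sublevel_bounded[of "energy u0"] by blast
  \<comment> \<open>The added 1 makes the inequality strict, as the a priori bound has to
    be.\<close>
  have small: "norm U < CARD('v) * r + 1"
    if "mass (($) U) = 1" "energy (($) U) \<le> energy u0" for U :: "real ^ 'v"
  proof -
    have "norm U \<le> (\<Sum>x\<in>UNIV. \<bar>U $ x\<bar>)"
      by (rule norm_le_l1_cart)
    also have "\<dots> \<le> of_nat CARD('v) * r"
      using r[OF that] by (intro sum_bounded_above)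
    finally show ?thesis
      by simp
  qed
  have "\<exists>U. U 0 = U0 \<and> continuous_on {0..} U \<and>
      (\<forall>t>0. (U has_vector_derivative field (U t)) (at t))"
  proof (rule ode_global_exists)
    show "ball_lipschitz field"
      by (rule ball_lipschitz_field)
    show "norm U0 < CARD('v) * r + 1"
      using assms by (intro small) (simp_all add: U0_def vec_lambda_inverse)
    show "norm (U T) < CARD('v) * r + 1"
      if "0 < T" "U 0 = U0" "continuous_on {0..T} U"
        "\<And>t. \<lbrakk>0 < t; t < T\<rbrakk> \<Longrightarrow> (U has_vector_derivative field (U t)) (at t)" for U T
      using flow_conserves_mass_and_decreases_energy[of 0 T U] that assms
      by (intro small) (simp_all add: U0_def vec_lambda_inverse)
  qed
  then show ?thesis
    using solves_flow_of_vec unfolding U0_def by blast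
qed

lemma flow_unique:
  assumes u: "solves_flow \<mu> lam \<phi> s \<rho> h u0 u" and v: "solves_flow \<mu> lam \<phi> s \<rho> h u0 v"
    and "0 \<le> t"
  shows "u x t = v x t"
proof -
  have "(\<chi> x. u x t) = (\<chi> x. v x t)"
  proof (rule ode_unique[of field])
    show "ball_lipschitz field"
      by (rule ball_lipschitz_field)
    show "(\<chi> x. u x 0) = (\<chi> x. v x 0)"
      using solves_flow_vec(1)[OF u] solves_flow_vec(1)[OF v] by simp
  qed (fact solves_flow_vec[OF u] solves_flow_vec[OF v] \<open>0 \<le> t\<close>)+
  then show ?thesis
    by (simp add: vec_eq_iff)
qed

lemma stationary_imp_mean_field:
  assumes mass: "mass u = 1" and stationary: "\<And>x. velocity u x = 0"
  shows "solves_mean_field \<mu> lam \<phi> s \<rho> h u"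
proof -
  have eq: "\<rho> * (\<mu> x * exp (u x) * (\<alpha> u * h x)) = - (\<Sum>y\<in>UNIV. W x y * u y) + \<mu> x * (\<rho> / volume \<mu>)"
    for x
    using energy_gradient[of x u] stationary[of x] by (simp add: velocity_def)
  \<comment> \<open>Sum the stationary equation over all vertices: the left side becomes
    \<open>\<rho> * \<alpha> u\<close> by the constraint, while the column sums of \<open>W\<close>
    vanish by symmetry and leave \<open>\<rho>\<close>.\<close>
  have "\<rho> * \<alpha> u = \<rho> * \<alpha> u * mass u"
    by (simp add: mass)
  also have "\<dots> = (\<Sum>x\<in>UNIV. \<rho> * (\<mu> x * exp (u x) * (\<alpha> u * h x)))"
    by (simp add: mass_def vintegral_def sum_distrib_left mult_ac)
  also have "\<dots> = - (\<Sum>x\<in>UNIV. \<Sum>y\<in>UNIV. W x y * u y) + (\<Sum>x\<in>UNIV. \<mu> x) * (\<rho> / volume \<mu>)"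
    unfolding eq by (simp only: sum.distrib sum_negf sum_distrib_right)
  also have "(\<Sum>x\<in>UNIV. \<Sum>y\<in>UNIV. W x y * u y) = (\<Sum>y\<in>UNIV. (\<Sum>x\<in>UNIV. W y x) * u y)"
    by (subst sum.swap) (simp add: sum_distrib_right frac_weight_sym)
  also have "\<dots> = 0"
    by (simp add: sum_frac_weight)
  finally have "\<rho> * \<alpha> u = \<rho>"
    using volume_pos by (simp add: volume_def)
  then have "\<alpha> u = 1"
    using \<rho>_pos by simp
  then have "\<mu> x * L u x = \<mu> x * (\<rho> * (h x * exp (u x) - 1 / volume \<mu>))" for x
    using eq[of x] by (simp add: measure_mult_frac_laplacian algebra_simps)
  moreover have "\<mu> x \<noteq> 0" for x
    using measure_pos[of x] by simp
  ultimately show ?thesis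
    using mass by (simp add: solves_mean_field_def flip: mass_def)
qed

lemma flow_subconverges:
  assumes "mass u0 = 1" and flow: "solves_flow \<mu> lam \<phi> s \<rho> h u0 u"
  shows "\<exists>t u_inf. strict_mono t \<and> (\<forall>n. 0 \<le> t n) \<and> filterlim t at_top sequentially \<and>
    mass u_inf = 1 \<and> uniform_limit UNIV (\<lambda>n x. u x (t n)) u_inf sequentially \<and>
    solves_mean_field \<mu> lam \<phi> s \<rho> h u_inf"
proof -
  define U where "U t = (\<chi> x. u x t)" for t
  have U0: "($) (U 0) = u0"
    using flow by (simp add: U_def solves_flow_def fun_eq_iff)
  have cont: "continuous_on S U" if "S \<subseteq> {0..}" for S
    using solves_flow_vec(2)[OF flow] that unfolding U_def by (rule continuous_on_subset)
  have deriv: "(U has_vector_derivative field (U t)) (at t)" if "0 < t" for t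
    using solves_flow_vec(3)[OF flow that] unfolding U_def .
  have mass_U: "mass (($) (U t)) = 1" if "0 \<le> t" for t
    using flow_conserves_mass_and_decreases_energy(1)[of 0 t U] cont deriv that assms(1) U0
    by simp
  have energy_U: "energy (($) (U b)) \<le> energy (($) (U a))" if "0 \<le> a" "a \<le> b" for a b
    using flow_conserves_mass_and_decreases_energy(2)[of a b U] cont deriv that by simp
  \<comment> \<open>Sampling starts at time 1, so that the equation holds on closed unit intervals
    including their endpoints.\<close>
  define e where "e n = energy (($) (U (real (Suc n))))" for n :: nat
  obtain m where "\<And>u. mass u = 1 \<Longrightarrow> m \<le> energy u"
    using energy_bounded_below by blast
  then have "decseq e" "\<And>n. m \<le> e n"
    using mass_U energy_U by (auto simp: e_def decseq_def)
  then obtain l where "e \<longlonglongrightarrow> l"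
    using decseq_convergent[of e m] by blast
  then have e_diff: "(\<lambda>n. e (Suc n) - e n) \<longlonglongrightarrow> 0"
    using tendsto_diff[OF LIMSEQ_Suc] by fastforce
  have "\<exists>t. real (Suc n) < t \<and> t < real (Suc (Suc n)) \<and> e (Suc n) - e n = - \<rho> * dissipation (($) (U t))" for n
  proof -
    \<comment> \<open>The mean value theorem finds in each unit interval a time at which the
      dissipation is the energy drop over that interval divided by \<open>\<rho>\<close>; these
      drops tend to zero.\<close>
    have "\<exists>t. real (Suc n) < t \<and> t < real (Suc (Suc n)) \<and>
        e (Suc n) - e n = (real (Suc (Suc n)) - real (Suc n)) * (- \<rho> * dissipation (($) (U t)))"
      unfolding e_def
    proof (rule MVT2)
      show "((\<lambda>t. energy (($) (U t))) has_real_derivative - \<rho> * dissipation (($) (U t))) (at t)"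
        if "real (Suc n) \<le> t" "t \<le> real (Suc (Suc n))" for t
        using that deriv[of t] by (intro energy_deriv nth_has_real_derivative) auto
    qed simp
    then show ?thesis
      by simp
  qed
  then obtain \<tau> where \<tau>: "\<And>n. real (Suc n) < \<tau> n" "\<And>n. \<tau> n < real (Suc (Suc n))"
    "\<And>n. e (Suc n) - e n = - \<rho> * dissipation (($) (U (\<tau> n)))"
    by metis
  have \<tau>_pos: "0 < \<tau> n" for n
    using \<tau>(1)[of n] by linarith
  have "(\<lambda>n. - (1 / \<rho>) * (e (Suc n) - e n)) \<longlonglongrightarrow> - (1 / \<rho>) * 0"
    using e_diff by (intro tendsto_intros)
  then have D0: "(\<lambda>n. dissipation (($) (U (\<tau> n)))) \<longlonglongrightarrow> 0"
    using \<rho>_pos by (simp add: \<tau>(3))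
  obtain r where r: "\<And>u x. mass u = 1 \<Longrightarrow> energy u \<le> energy u0 \<Longrightarrow> \<bar>u x\<bar> \<le> r"
    using sublevel_bounded[of "energy u0"] by blast
  have "norm (U t) \<le> of_nat CARD('v) * r" if "0 \<le> t" for t
  proof -
    have "norm (U t) \<le> (\<Sum>x\<in>UNIV. \<bar>U t $ x\<bar>)"
      by (rule norm_le_l1_cart)
    also have "\<dots> \<le> of_nat CARD('v) * r"
      using r[OF mass_U energy_U[of 0 t, unfolded U0]] that by (intro sum_bounded_above) auto
    finally show ?thesis .
  qed
  then have "U (\<tau> n) \<in> cball 0 (of_nat CARD('v) * r)" for n
    using \<tau>_pos[of n] by simp
  then obtain V q where q: "strict_mono q" and V: "((\<lambda>n. U (\<tau> n)) \<circ> q) \<longlonglongrightarrow> V"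
    using compact_cball[unfolded compact_def] by metis
  define t where "t = \<tau> \<circ> q"
  have V: "(\<lambda>n. U (t n)) \<longlonglongrightarrow> V"
    using V by (simp add: t_def o_def)
  \<comment> \<open>The chosen times lie in consecutive disjoint open intervals.\<close>
  have "strict_mono \<tau>"
    unfolding strict_mono_Suc_iff using \<tau>(1,2) by (meson less_trans)
  then have "strict_mono t"
    unfolding t_def using q strict_mono_o by blast
  moreover have "0 \<le> t n" for n
    using \<tau>_pos[of "q n"] by (simp add: t_def)
  moreover have "filterlim t at_top sequentially"
  proof (rule filterlim_at_top_mono[OF filterlim_real_sequentially])
    have "real n \<le> t n" for n
      using seq_suble[OF q, of n] \<tau>(1)[of "q n"] by (simp add: t_def)
    then show "\<forall>\<^sub>F n in sequentially. real n \<le> t n"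
      by simp
  qed
  moreover have mass_V: "mass (($) V) = 1"
  proof -
    have "isCont (\<lambda>U :: real ^ 'v. mass (($) U)) V"
      using continuous_on_mass[OF continuous_on_id, of UNIV] by (simp add: continuous_on_eq_continuous_at)
    then have "(\<lambda>n. mass (($) (U (t n)))) \<longlonglongrightarrow> mass (($) V)"
      using V by (rule isCont_tendsto_compose)
    then show ?thesis
      using mass_U \<open>\<And>n. 0 \<le> t n\<close> by (simp add: LIMSEQ_const_iff)
  qed
  moreover have "uniform_limit UNIV (\<lambda>n x. u x (t n)) (($) V) sequentially"
    unfolding uniform_limit_iff
  proof (intro allI impI)
    fix \<epsilon> :: real
    assume "0 < \<epsilon>"
    with V have "\<forall>\<^sub>F n in sequentially. dist (U (t n)) V < \<epsilon>"
      by (rule tendstoD)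
    then show "\<forall>\<^sub>F n in sequentially. \<forall>x\<in>UNIV. dist (u x (t n)) (V $ x) < \<epsilon>"
    proof (rule eventually_mono)
      fix n
      assume "dist (U (t n)) V < \<epsilon>"
      then show "\<forall>x\<in>UNIV. dist (u x (t n)) (V $ x) < \<epsilon>"
        using dist_vec_nth_le[of "U (t n)" _ V] by (auto simp: U_def intro: le_less_trans)
    qed
  qed
  moreover have "solves_mean_field \<mu> lam \<phi> s \<rho> h (($) V)"
  proof -
    have "isCont (\<lambda>U :: real ^ 'v. dissipation (($) U)) V"
      using continuous_on_dissipation[of UNIV] by (simp add: continuous_on_eq_continuous_at)
    then have "(\<lambda>n. dissipation (($) (U (t n)))) \<longlonglongrightarrow> dissipation (($) V)"
      using V by (rule isCont_tendsto_compose)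
    moreover have "(\<lambda>n. dissipation (($) (U (t n)))) \<longlonglongrightarrow> 0"
      using LIMSEQ_subseq_LIMSEQ[OF D0 q] by (simp add: t_def o_def)
    ultimately have "dissipation (($) V) = 0"
      by (rule LIMSEQ_unique)
    then show ?thesis
      using mass_V by (intro stationary_imp_mean_field) (simp_all add: dissipation_eq_0_iff)
  qed
  ultimately show ?thesis
    by blast
qed

end

theorem theorem2p5:
  fixes E :: "'v::finite rel"
    and w :: "'v \<Rightarrow> 'v \<Rightarrow> real"
    and \<mu> :: "'v \<Rightarrow> real"
    and lam :: "nat \<Rightarrow> real"
    and \<phi> :: "nat \<Rightarrow> 'v \<Rightarrow> real"
    and s \<rho> :: real
    and h u0 :: "'v \<Rightarrow> real"
  assumes "weighted_graph E w \<mu>"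
    and "laplacian_eigensystem E w \<mu> lam \<phi>"
    and "0 < s" and "s < 1"
    and "0 < \<rho>"
    and "(\<exists>x. h x > 0) \<and> (\<exists>x. h x < 0)"
    and "Max (range h) > 0"
    and "u0 \<in> constraint_set \<mu> lam \<phi> s h"
  shows "(\<exists>u. solves_flow \<mu> lam \<phi> s \<rho> h u0 u \<and>
            (\<forall>v. solves_flow \<mu> lam \<phi> s \<rho> h u0 v \<longrightarrow> (\<forall>x. \<forall>t\<ge>0. v x t = u x t)))
    \<and> (\<forall>u. solves_flow \<mu> lam \<phi> s \<rho> h u0 u \<longrightarrow>
        (\<exists>(t :: nat \<Rightarrow> real) u_inf.
            strict_mono t \<and> (\<forall>n. 0 \<le> t n) \<and> filterlim t at_top sequentially \<and>
            u_inf \<in> constraint_set \<mu> lam \<phi> s h \<and>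
            uniform_limit UNIV (\<lambda>n x. u x (t n)) u_inf sequentially \<and>
            solves_mean_field \<mu> lam \<phi> s \<rho> h u_inf))"
proof -
  \<comment> \<open>A point with \<open>h x \<noteq> 0\<close> keeps the denominator of
    \<open>\<alpha>\<close> positive.\<close>
  have "\<exists>x. h x \<noteq> 0"
    using assms(6) by (metis less_irrefl)
  then interpret mean_field_flow E w \<mu> lam \<phi> s \<rho> h
    using assms
    by (intro mean_field_flow.intro spectral_graph.intro spectral_graph_axioms.intro
        mean_field_flow_axioms.intro)
  have "mass u0 = 1"
    using assms(8) by (simp add: mem_constraint_set_iff)
  show ?thesis
  proof (rule conjI)
    obtain u where "solves_flow \<mu> lam \<phi> s \<rho> h u0 u"
      using flow_exists[OF \<open>mass u0 = 1\<close>] by blast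
    then show "\<exists>u. solves_flow \<mu> lam \<phi> s \<rho> h u0 u \<and>
        (\<forall>v. solves_flow \<mu> lam \<phi> s \<rho> h u0 v \<longrightarrow> (\<forall>x. \<forall>t\<ge>0. v x t = u x t))"
      using flow_unique by blast
  qed (use flow_subconverges[OF \<open>mass u0 = 1\<close>] in \<open>simp add: mem_constraint_set_iff\<close>)
qed

end
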